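(* Let $A_0,B_0\in\mathbb{R}^{n\times n}$ be nonpermutable matrices, $A_0B_0\neq B_0A_0$, let $1<\alpha\le2$, $0<\beta\le1$, $\eta,\hat\eta\in\mathbb{R}^n$, and let $g:\mathbb{J}\to\mathbb{R}^n$ be continuous. The exact analytical solution $y(\cdot)\in\mathbb{C}^2(\mathbb{J},\mathbb{R}^n)$ of the initial value problem $$\left({}^{C}D^{\alpha}_{0+}y\right)(t)-A_0\left({}^{C}D^{\beta}_{0+}y\right)(t)-B_0y(t)=g(t),\quad t>0,\qquad y(0)=\eta,\quad y'(0)=\hat\eta,$$ can be expressed, for $t>0$, by $$\begin{aligned}y(t)&=\big(I+t^{\alpha}\mathscr{E}^{A_0,B_0}_{\alpha-\beta,\alpha,\alpha+1}(t)B_0\big)\eta+t\,\mathscr{E}^{A_0,B_0}_{\alpha-\beta,\alpha,2}(t)\hat\eta+\int_0^t(t-s)^{\alpha-1}\mathscr{E}^{A_0,B_0}_{\alpha-\beta,\alpha,\alpha}(t-s)g(s)\,ds\\&=\Big(I+\sum_{k=0}^{\infty}\sum_{m=0}^{\infty}Q_{k,m}^{A_0,B_0}B_0\frac{t^{k(\alpha-\beta)+m\alpha+\alpha}}{\Gamma(k(\alpha-\beta)+m\alpha+\alpha+1)}\Big)\eta+\sum_{k=0}^{\infty}\sum_{m=0}^{\infty}Q_{k,m}^{A_0,B_0}\frac{t^{k(\alpha-\beta)+m\alpha+1}}{\Gamma(k(\alpha-\beta)+m\alpha+2)}\hat\eta\\&\quad+\int_0^t\sum_{k=0}^{\infty}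\sum_{m=0}^{\infty}Q_{k,m}^{A_0,B_0}\frac{(t-s)^{k(\alpha-\beta)+m\alpha+\alpha-1}}{\Gamma(k(\alpha-\beta)+m\alpha+\alpha)}g(s)\,ds.\end{aligned}$$
   Context: $\mathbb{J}=[0,T]$; $\mathbb{C}^2(\mathbb{J},\mathbb{R}^n)$ is the space of twice continuously differentiable functions $\mathbb{J}\to\mathbb{R}^n$; $I$ is the identity matrix. For $N-1<\nu\le N$, $N\in\mathbb{N}$, the Caputo derivative is $({}^{C}D^{\nu}_{0+}y)(t)=\frac{1}{\Gamma(N-\nu)}\int_0^t(t-s)^{N-\nu-1}y^{(N)}(s)\,ds$, understood as $y^{(N)}(t)$ when $\nu=N$. The matrices $Q_{k,m}^{A_0,B_0}$, $k,m\in\mathbb{N}_0$, are defined by $Q_{k,0}^{A_0,B_0}=A_0^k$ ($k\in\mathbb{N}_0$), $Q_{0,m}^{A_0,B_0}=B_0^m$ ($m\in\mathbb{N}_0$), and $Q_{k,m}^{A_0,B_0}=\sum_{l=0}^{k}A_0^{k-l}B_0Q_{l,m-1}^{A_0,B_0}$ ($k,m\in\mathbb{N}$). For $a,b>0$, $c\in\mathbb{R}$, $\mathscr{E}^{A_0,B_0}_{a,b,c}(t)=\sum_{k=0}^{\infty}\sum_{m=0}^{\infty}Q_{k,m}^{A_0,B_0}\frac{t^{ka+mb}}{\Gamma(ka+mb+c)}$. *)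

theory Defs
  imports "HOL-Analysis.Analysis"
begin

(* Derivatives are taken within J, hence one-sided at the end points of an interval;
   only the values of y on J matter. *)
primrec nth_deriv_within :: "real set \<Rightarrow> nat \<Rightarrow> (real \<Rightarrow> 'a::real_normed_vector) \<Rightarrow> real \<Rightarrow> 'a"
  where
    "nth_deriv_within J 0 y = y"
  | "nth_deriv_within J (Suc k) y = (\<lambda>t. vector_derivative (nth_deriv_within J k y) (at t within J))"

definition continuously_differentiable_on ::
    "nat \<Rightarrow> real set \<Rightarrow> (real \<Rightarrow> 'a::real_normed_vector) \<Rightarrow> bool"
  where
    "continuously_differentiable_on k J y \<longleftrightarrow>
       (\<forall>j<k. nth_deriv_within J j y differentiable_on J) \<and>
       continuous_on J (nth_deriv_within J k y)"

(* For nu > 0 the number N is determined by N - 1 < nu <= N. *)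
definition caputo_derivative ::
    "real set \<Rightarrow> real \<Rightarrow> (real \<Rightarrow> 'a::euclidean_space) \<Rightarrow> real \<Rightarrow> 'a"
  where
    "caputo_derivative J \<nu> y t =
       (let N = nat \<lceil>\<nu>\<rceil> in
        if \<nu> = real N then nth_deriv_within J N y t
        else (1 / Gamma (real N - \<nu>)) *\<^sub>R
               integral {0..t} (\<lambda>s. (t - s) powr (real N - \<nu> - 1) *\<^sub>R nth_deriv_within J N y s))"

(* The library's power operation on real^'n^'n is componentwise. *)
primrec matrix_power :: "real^'n^'n \<Rightarrow> nat \<Rightarrow> real^'n^'n"
  where
    "matrix_power A 0 = mat 1"
  | "matrix_power A (Suc k) = A ** matrix_power A k"

fun Q_matrix :: "real^'n^'n \<Rightarrow> real^'n^'n \<Rightarrow> nat \<Rightarrow> nat \<Rightarrow> real^'n^'n"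
  where
    "Q_matrix A B k 0 = matrix_power A k"
  | "Q_matrix A B 0 m = matrix_power B m"
  | "Q_matrix A B (Suc k) (Suc m) =
       (\<Sum>l\<le>Suc k. matrix_power A (Suc k - l) ** B ** Q_matrix A B l m)"

definition double_suminf :: "(nat \<Rightarrow> nat \<Rightarrow> 'a::real_normed_vector) \<Rightarrow> 'a"
  where "double_suminf f = (\<Sum>k. \<Sum>m. f k m)"

(* suminf is a total function and meaningless for divergent series, so convergence of the iterated series
   has to be stated separately. *)
definition double_summable :: "(nat \<Rightarrow> nat \<Rightarrow> 'a::real_normed_vector) \<Rightarrow> bool"
  where "double_summable f \<longleftrightarrow> (\<forall>k. summable (f k)) \<and> summable (\<lambda>k. \<Sum>m. f k m)"

definition mittag_leffler_term ::
    "real^'n^'n \<Rightarrow> real^'n^'n \<Rightarrow> real \<Rightarrow> real \<Rightarrow> real \<Rightarrow> real \<Rightarrow> nat \<Rightarrow> nat \<Rightarrow> real^'n^'n"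
  where
    "mittag_leffler_term A B a b c t k m =
       (t powr (real k * a + real m * b) / Gamma (real k * a + real m * b + c)) *\<^sub>R Q_matrix A B k m"

(* Intended for t > 0.  Because 0 powr 0 = 0, the value at t = 0 lacks the term k = m = 0;
   in the solution formula that value occurs only at s = t in the integrand, multiplied by
   (t - s) powr (alpha - 1) = 0. *)
definition mittag_leffler ::
    "real^'n^'n \<Rightarrow> real^'n^'n \<Rightarrow> real \<Rightarrow> real \<Rightarrow> real \<Rightarrow> real \<Rightarrow> real^'n^'n"
  where
    "mittag_leffler A B a b c t = double_suminf (mittag_leffler_term A B a b c t)"

definition solves_ivp ::
    "real \<Rightarrow> real \<Rightarrow> real \<Rightarrow> real^'n^'n \<Rightarrow> real^'n^'n \<Rightarrow> (real \<Rightarrow> real^'n) \<Rightarrow>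
     real^'n \<Rightarrow> real^'n \<Rightarrow> (real \<Rightarrow> real^'n) \<Rightarrow> bool"
  where
    "solves_ivp T \<alpha> \<beta> A B g \<eta> \<eta>' y \<longleftrightarrow>
       (\<forall>t\<in>{0<..T}. caputo_derivative {0..T} \<alpha> y t - A *v caputo_derivative {0..T} \<beta> y t - B *v y t = g t) \<and>
       y 0 = \<eta> \<and> nth_deriv_within {0..T} 1 y 0 = \<eta>'"

end

theory Submission
  imports Defs
begin

text \<open>
  Write \<open>a = \<alpha> - \<beta>\<close> and let \<open>I\<^sup>p\<close> be the Riemann--Liouville integral of order \<open>p\<close>. Applying
  \<open>I\<^sup>\<alpha>\<close> to the differential equation turns it into a Volterra equation for \<open>z = y - \<eta>\<close>,
  namely \<open>z - A (I\<^sup>a z) - B (I\<^sup>\<alpha> z) = F\<close> with \<open>F\<close> built from \<open>\<eta>\<close>, \<open>\<eta>'\<close> and \<open>I\<^sup>\<alpha> g\<close>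
  (\<open>ivp_frac_integral\<close>). Its solution is the Neumann series of the operator
  \<open>A I\<^sup>a + B I\<^sup>\<alpha>\<close>. The fractional integrals commute with the matrices and with each other, while the
  order of the matrices matters, so the \<open>n\<close>-th power of this operator is the sum of
  \<open>Q_matrix A B k m\<close> times the fractional integral of order \<open>k a + m \<alpha>\<close> over \<open>k + m = n\<close>, because
  \<open>Q_matrix A B k m\<close> is the sum of all words in \<open>k\<close> letters \<open>A\<close> and \<open>m\<close> letters \<open>B\<close>
  (\<open>Q_matrix_right\<close>, \<open>Q_matrix_neumann_sums\<close>). Applied to the three parts of \<open>F\<close>, the series yields
  the three summands of the solution formula (\<open>ivp_solution_formula\<close>).

  The semigroup law \<open>I\<^sup>p I\<^sup>q = I\<^bsup>p+q\<^esup>\<close> (\<open>frac_integral_semigroup\<close>) is read off from the Beta integral on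
  powers and extended to continuous functions by uniform polynomial approximation. Convergence of
  all series rests on one bound: the Gamma function outgrows every exponential, so the terms
  are dominated by a product of two geometric sequences, uniformly on compact time intervals
  (\<open>ml_term_bound\<close>). This makes the remainder of the Neumann series vanish, permits summation
  along diagonals in place of the iterated sum (\<open>geometric_double_series\<close>), and allows the
  series under the integral sign to be integrated term by term (\<open>ml_convolution_sums\<close>). The argument
  starts from an arbitrary solution \<open>y\<close> and recovers it from the data, so it contains the uniqueness of
  the solution.
\<close>

section \<open>The Riemann--Liouville fractional integral\<close>

text \<open>
  The value \<open>f t\<close> at order \<open>0\<close> makes the semigroup law hold for all nonnegative orders, and makes a
  Caputo derivative of order \<open>\<nu>\<close> the fractional integral of order \<open>N - \<nu>\<close> of the \<open>N\<close>-th derivative,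
  including the case \<open>\<nu> = N\<close>.
\<close>

definition frac_integral :: "real \<Rightarrow> (real \<Rightarrow> 'a::euclidean_space) \<Rightarrow> real \<Rightarrow> 'a"
  where "frac_integral p f t =
    (if p = 0 then f t else (1 / Gamma p) *\<^sub>R integral {0..t} (\<lambda>s. (t - s) powr (p - 1) *\<^sub>R f s))"

text \<open>
  Euler's Beta integral over the unit interval, stretched by the factor \<open>t\<close>.
\<close>

lemma has_integral_power_convolution:
  fixes p r t :: real
  assumes "p > 0" "r > -1" "t \<ge> 0"
  shows "((\<lambda>s. (t - s) powr (p - 1) * s powr r) has_integral
           t powr (p + r) * Beta (r + 1) p) {0..t}"
proof (cases "t = 0")
  case False
  then have t: "t > 0" using assms by simp
  have "((\<lambda>x. x powr (r + 1 - 1) * (1 - x) powr (p - 1)) has_integral Beta (r + 1) p) {0..1}"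
    using has_integral_Beta_real[of "r + 1" p] assms by simp
  then have "((\<lambda>x. x powr r * (1 - x) powr (p - 1)) has_integral Beta (r + 1) p) {0..1}"
    by simp
  from has_integral_stretch_real[OF this, of "1 / t"] t
  have "((\<lambda>s. (s / t) powr r * (1 - s / t) powr (p - 1)) has_integral t * Beta (r + 1) p)
          ((\<lambda>x. x * t) ` {0..1})"
    by simp
  moreover have "(\<lambda>x. x * t) ` {0..1} = {0..t}"
    using t image_mult_atLeastAtMost[of t 0 1] by (simp add: mult.commute)
  ultimately have "((\<lambda>s. (s / t) powr r * (1 - s / t) powr (p - 1)) has_integral t * Beta (r + 1) p) {0..t}"
    by simp
  from has_integral_mult_right[OF this, of "t powr (p + r - 1)"]
  have "((\<lambda>s. t powr (p + r - 1) * ((s / t) powr r * (1 - s / t) powr (p - 1))) has_integral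
          t powr (p + r) * Beta (r + 1) p) {0..t}"
    using t by (simp add: powr_diff)
  moreover have "t powr (p + r - 1) * ((s / t) powr r * (1 - s / t) powr (p - 1)) =
      (t - s) powr (p - 1) * s powr r" if "s \<in> {0..t}" for s
  proof -
    have "1 - s / t = (t - s) / t" using t by (simp add: field_simps)
    then have "(1 - s / t) powr (p - 1) = (t - s) powr (p - 1) / t powr (p - 1)"
      using that t by (simp add: powr_divide)
    moreover have "(s / t) powr r = s powr r / t powr r"
      using that t by (simp add: powr_divide)
    moreover have "t powr (p + r - 1) = t powr r * t powr (p - 1)"
      using powr_add[of t r "p - 1"] by (simp add: add.commute add_diff_eq)
    ultimately show ?thesis using t by (simp add: field_simps)
  qed
  ultimately show ?thesis
    by (rule has_integral_eq[rotated])
qed (simp add: has_integral_refl)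

text \<open>
  With the normalisation \<open>s powr r / Gamma (r + 1)\<close> the fractional integral merely shifts the
  exponent; this is the semigroup law on powers, from which the general law follows by density.
\<close>

lemma frac_integral_powr:
  fixes v :: "'a::euclidean_space"
  assumes "p > 0" "r > -1" "t \<ge> 0"
  shows "frac_integral p (\<lambda>s. (s powr r / Gamma (r + 1)) *\<^sub>R v) t
          = (t powr (p + r) / Gamma (p + r + 1)) *\<^sub>R v"
proof -
  have "((\<lambda>s. ((t - s) powr (p - 1) * s powr r) *\<^sub>R ((1 / Gamma (r + 1)) *\<^sub>R v)) has_integral
        (t powr (p + r) * Beta (r + 1) p) *\<^sub>R ((1 / Gamma (r + 1)) *\<^sub>R v)) {0..t}"
    by (intro has_integral_scaleR_left has_integral_power_convolution assms)
  then have "integral {0..t} (\<lambda>s. (t - s) powr (p - 1) *\<^sub>R ((s powr r / Gamma (r + 1)) *\<^sub>R v))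
      = (t powr (p + r) * Beta (r + 1) p / Gamma (r + 1)) *\<^sub>R v"
    by (intro integral_unique) simp
  moreover have "Gamma (r + 1) \<noteq> 0" "Gamma p \<noteq> 0"
    using assms Gamma_real_pos[of "r + 1"] Gamma_real_pos[of p] by linarith+
  ultimately show ?thesis using assms
    by (simp add: frac_integral_def Beta_def add_ac)
qed

text \<open>
  The point \<open>0\<close> is negligible. This matters twice: \<open>0 powr 0\<close> and \<open>0 ^ 0\<close> differ, and the differential
  equation is only given for positive times.
\<close>

lemma frac_integral_cong_Ioc:
  assumes "\<And>s. s \<in> {0<..t} \<Longrightarrow> f s = g s" "p > 0"
  shows "frac_integral p f t = frac_integral p g t"
proof -
  have "integral {0..t} (\<lambda>s. (t - s) powr (p - 1) *\<^sub>R f s)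
      = integral {0..t} (\<lambda>s. (t - s) powr (p - 1) *\<^sub>R g s)"
    by (rule integral_spike[of "{0}"]) (use assms in auto)
  then show ?thesis using assms by (simp add: frac_integral_def)
qed

lemma frac_integral_cong:
  assumes "\<And>s. s \<in> {0..t} \<Longrightarrow> f s = g s" "t \<ge> 0"
  shows "frac_integral p f t = frac_integral p g t"
proof -
  have "integral {0..t} (\<lambda>s. (t - s) powr (p - 1) *\<^sub>R f s)
      = integral {0..t} (\<lambda>s. (t - s) powr (p - 1) *\<^sub>R g s)"
    by (rule integral_cong) (use assms in auto)
  then show ?thesis using assms by (simp add: frac_integral_def)
qed

lemma frac_integral_monomial:
  fixes v :: "'a::euclidean_space"
  assumes "p > 0" "t \<ge> 0"
  shows "frac_integral p (\<lambda>s. (s ^ n / Gamma (real n + 1)) *\<^sub>R v) t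
          = (t powr (p + real n) / Gamma (p + real n + 1)) *\<^sub>R v"
proof -
  have "frac_integral p (\<lambda>s. (s ^ n / Gamma (real n + 1)) *\<^sub>R v) t
      = frac_integral p (\<lambda>s. (s powr real n / Gamma (real n + 1)) *\<^sub>R v) t"
    by (rule frac_integral_cong_Ioc) (use assms in \<open>auto simp: powr_realpow\<close>)
  then show ?thesis using assms by (simp add: frac_integral_powr)
qed

text \<open>
  For \<open>p < 1\<close> the kernel is unbounded at \<open>s = t\<close>, but it is absolutely integrable, and multiplying by a
  bounded measurable function preserves this.
\<close>

lemma weakly_singular_integrable:
  fixes f :: "real \<Rightarrow> 'a::euclidean_space"
  assumes "p > 0" "t \<ge> 0" "continuous_on {0..t} f"
  shows "(\<lambda>s. (t - s) powr (p - 1) *\<^sub>R f s) integrable_on {0..t}"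
proof -
  have "(\<lambda>s. (t - s) powr (p - 1) * s powr 0) integrable_on {0..t}"
    using has_integral_power_convolution[of p 0 t] assms by auto
  then have "(\<lambda>s. (t - s) powr (p - 1) * s powr 0) absolutely_integrable_on {0..t}"
    by (rule nonnegative_absolutely_integrable_1) auto
  then have "(\<lambda>s. (t - s) powr (p - 1)) absolutely_integrable_on {0..t}"
    by (rule absolutely_integrable_spike[where S="{0}"]) auto
  moreover have "f \<in> borel_measurable (lebesgue_on {0..t})"
    by (rule continuous_imp_measurable_on_sets_lebesgue[OF assms(3)]) simp
  moreover have "bounded (f ` {0..t})"
    by (intro compact_imp_bounded compact_continuous_image assms) simp
  moreover have "bilinear (\<lambda>(x::'a) (c::real). c *\<^sub>R x)"
    by (auto simp: bilinear_def intro!: linearI simp: scaleR_add_left scaleR_add_right)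
  ultimately have "(\<lambda>s. (t - s) powr (p - 1) *\<^sub>R f s) absolutely_integrable_on {0..t}"
    using absolutely_integrable_bounded_measurable_product
      [where h = "\<lambda>(x::'a) (c::real). c *\<^sub>R x" and f = f and S = "{0..t}"
        and g = "\<lambda>s. (t - s) powr (p - 1)"] by simp
  then show ?thesis
    by (rule set_lebesgue_integral_eq_integral(1))
qed

lemma frac_integral_add:
  fixes f g :: "real \<Rightarrow> 'a::euclidean_space"
  assumes "p \<ge> 0" "t \<ge> 0" "continuous_on {0..t} f" "continuous_on {0..t} g"
  shows "frac_integral p (\<lambda>s. f s + g s) t = frac_integral p f t + frac_integral p g t"
proof (cases "p = 0")
  case False
  then have "p > 0" using assms by simp
  note int = weakly_singular_integrable[OF this assms(2)]
  have "integral {0..t} (\<lambda>s. (t - s) powr (p - 1) *\<^sub>R f s + (t - s) powr (p - 1) *\<^sub>R g s)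
      = integral {0..t} (\<lambda>s. (t - s) powr (p - 1) *\<^sub>R f s)
        + integral {0..t} (\<lambda>s. (t - s) powr (p - 1) *\<^sub>R g s)"
    by (rule integral_add[OF int[OF assms(3)] int[OF assms(4)]])
  then show ?thesis
    using False by (simp add: frac_integral_def scaleR_add_right)
qed (simp add: frac_integral_def)

lemma frac_integral_diff:
  fixes f g :: "real \<Rightarrow> 'a::euclidean_space"
  assumes "p \<ge> 0" "t \<ge> 0" "continuous_on {0..t} f" "continuous_on {0..t} g"
  shows "frac_integral p (\<lambda>s. f s - g s) t = frac_integral p f t - frac_integral p g t"
proof (cases "p = 0")
  case False
  then have "p > 0" using assms by simp
  note int = weakly_singular_integrable[OF this assms(2)]
  have "integral {0..t} (\<lambda>s. (t - s) powr (p - 1) *\<^sub>R f s - (t - s) powr (p - 1) *\<^sub>R g s)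
      = integral {0..t} (\<lambda>s. (t - s) powr (p - 1) *\<^sub>R f s)
        - integral {0..t} (\<lambda>s. (t - s) powr (p - 1) *\<^sub>R g s)"
    by (rule integral_diff[OF int[OF assms(3)] int[OF assms(4)]])
  then show ?thesis
    using False by (simp add: frac_integral_def scaleR_diff_right)
qed (simp add: frac_integral_def)

lemma frac_integral_linear:
  fixes f :: "real \<Rightarrow> 'a::euclidean_space" and h :: "'a \<Rightarrow> 'b::euclidean_space"
  assumes "p \<ge> 0" "t \<ge> 0" "continuous_on {0..t} f" "bounded_linear h"
  shows "frac_integral p (\<lambda>s. h (f s)) t = h (frac_integral p f t)"
proof (cases "p = 0")
  case False
  then have "p > 0" using assms by simp
  then have "integral {0..t} (h \<circ> (\<lambda>s. (t - s) powr (p - 1) *\<^sub>R f s))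
      = h (integral {0..t} (\<lambda>s. (t - s) powr (p - 1) *\<^sub>R f s))"
    by (rule integral_linear[OF weakly_singular_integrable[OF _ assms(2,3)] assms(4)])
  moreover have "linear h" using assms(4) by (simp add: bounded_linear.linear)
  ultimately show ?thesis
    using False by (simp add: frac_integral_def o_def linear_scale)
qed (simp add: frac_integral_def)

lemma frac_integral_bound:
  fixes f :: "real \<Rightarrow> 'a::euclidean_space"
  assumes "p > 0" "t \<ge> 0" "continuous_on {0..t} f" "\<And>s. s \<in> {0..t} \<Longrightarrow> norm (f s) \<le> M"
  shows "norm (frac_integral p f t) \<le> t powr p / Gamma (p + 1) * M"
proof -
  have eq: "frac_integral p (\<lambda>s. (s ^ 0 / Gamma (real 0 + 1)) *\<^sub>R M) t
      = (t powr (p + real 0) / Gamma (p + real 0 + 1)) *\<^sub>R M"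
    by (rule frac_integral_monomial) (use assms in auto)
  have "norm (integral {0..t} (\<lambda>s. (t - s) powr (p - 1) *\<^sub>R f s))
      \<le> integral {0..t} (\<lambda>s. (t - s) powr (p - 1) *\<^sub>R M)"
    by (rule integral_norm_bound_integral
          [OF weakly_singular_integrable[OF assms(1,2,3)]
              weakly_singular_integrable[OF assms(1,2) continuous_on_const]])
       (use assms(4) in \<open>auto intro!: mult_left_mono\<close>)
  then have "norm (frac_integral p f t) \<le> frac_integral p (\<lambda>s. M) t"
    using assms by (simp add: frac_integral_def divide_right_mono abs_of_pos)
  also have "\<dots> = t powr p / Gamma (p + 1) * M"
    using eq by simp
  finally show ?thesis .
qed

section \<open>Continuity and semigroup law by polynomial approximation\<close>

text \<open>
  An induction principle that packages the Weierstrass theorem: a property of continuous functions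
  holds once it holds for monomials and survives sums and uniform limits. For
  fractional integrals this reduces everything to powers, where the integrals are explicit.
\<close>

lemma continuous_on_monomial_induct [consumes 1, case_names monomial add limit]:
  fixes f :: "real \<Rightarrow> 'a::euclidean_space"
  assumes "continuous_on {0..T} f"
    and monomial: "\<And>n v. P (\<lambda>t. t ^ n *\<^sub>R v)"
    and add: "\<And>f g. continuous_on {0..T} f \<Longrightarrow> continuous_on {0..T} g \<Longrightarrow>
                P f \<Longrightarrow> P g \<Longrightarrow> P (\<lambda>t. f t + g t)"
    and limit: "\<And>f. continuous_on {0..T} f \<Longrightarrow>
                 (\<And>e. e > 0 \<Longrightarrow> \<exists>g. continuous_on {0..T} g \<and> P g \<and> (\<forall>t\<in>{0..T}. norm (f t - g t) \<le> e)) \<Longrightarrow> P f"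
  shows "P f"
proof (rule limit[OF assms(1)])
  have sum: "P (\<lambda>t. \<Sum>i\<in>I. h i t)"
    if "finite I" "\<And>i. i \<in> I \<Longrightarrow> P (h i)" "\<And>i. i \<in> I \<Longrightarrow> continuous_on {0..T} (h i)"
    for I :: "'i set" and h
    using that
  proof (induction I rule: finite_induct)
    case empty
    show ?case using monomial[of 0 0] by simp
  next
    case (insert i I)
    then show ?case
      using add[of "h i" "\<lambda>t. \<Sum>i\<in>I. h i t"] by (simp add: continuous_on_sum)
  qed
  fix e :: real assume "e > 0"
  then obtain g where g: "polynomial_function g" "\<forall>t\<in>{0..T}. norm (f t - g t) < e"
    using Stone_Weierstrass_polynomial_function[OF _ assms(1)] by auto
  have "\<exists>a n. (\<lambda>x. g x \<bullet> b) = (\<lambda>x. \<Sum>i\<le>n. a i * x ^ i)" for b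
    using g(1) bounded_linear_inner_left[of b]
    unfolding polynomial_function_def real_polynomial_function_iff_sum[symmetric] o_def by blast
  then obtain a n where an: "\<And>b. (\<lambda>x. g x \<bullet> b) = (\<lambda>x. \<Sum>i\<le>n b. a b i * x ^ i)"
    by metis
  have g_eq: "g = (\<lambda>x. \<Sum>b\<in>Basis. \<Sum>i\<le>n b. x ^ i *\<^sub>R (a b i *\<^sub>R b))"
  proof
    fix x
    have "g x = (\<Sum>b\<in>Basis. (g x \<bullet> b) *\<^sub>R b)"
      by (simp add: euclidean_representation)
    also have "\<dots> = (\<Sum>b\<in>Basis. \<Sum>i\<le>n b. x ^ i *\<^sub>R (a b i *\<^sub>R b))"
      by (intro sum.cong refl) (simp add: fun_cong[OF an] scaleR_sum_left mult.commute)
    finally show "g x = (\<Sum>b\<in>Basis. \<Sum>i\<le>n b. x ^ i *\<^sub>R (a b i *\<^sub>R b))" .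
  qed
  have "P g"
    unfolding g_eq by (intro sum monomial finite_Basis finite_atMost continuous_intros)
  moreover have "continuous_on {0..T} g"
    unfolding g_eq by (intro continuous_intros)
  ultimately show "\<exists>g. continuous_on {0..T} g \<and> P g \<and> (\<forall>t\<in>{0..T}. norm (f t - g t) \<le> e)"
    using g(2) by (intro exI[of _ g]) (auto simp: less_imp_le)
qed

text \<open>
  Lipschitz continuity in the supremum norm, which carries statements over to uniform limits.
\<close>

lemma frac_integral_diff_bound:
  fixes f g :: "real \<Rightarrow> 'a::euclidean_space"
  assumes "p > 0" "t \<in> {0..T}" "continuous_on {0..T} f" "continuous_on {0..T} g"
    and "\<And>s. s \<in> {0..T} \<Longrightarrow> norm (f s - g s) \<le> e"
  shows "norm (frac_integral p f t - frac_integral p g t) \<le> T powr p / Gamma (p + 1) * e"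
proof -
  have t: "t \<ge> 0" "t \<le> T" "{0..t} \<subseteq> {0..T}" using assms(2) by auto
  note cont = continuous_on_subset[OF assms(3) t(3)] continuous_on_subset[OF assms(4) t(3)]
  have "e \<ge> 0" using assms(5)[OF assms(2)] norm_ge_zero order_trans by blast
  have "norm (frac_integral p f t - frac_integral p g t) = norm (frac_integral p (\<lambda>s. f s - g s) t)"
    using assms(1) t cont by (simp add: frac_integral_diff)
  also have "\<dots> \<le> t powr p / Gamma (p + 1) * e"
    using assms t by (intro frac_integral_bound continuous_on_diff cont) auto
  also have "\<dots> \<le> T powr p / Gamma (p + 1) * e"
    using assms t \<open>e \<ge> 0\<close> by (intro mult_right_mono divide_right_mono powr_mono2) auto
  finally show ?thesis .
qed

lemma frac_integral_power_scaled:
  fixes v :: "'a::euclidean_space"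
  assumes "p > 0" "t \<ge> 0"
  shows "frac_integral p (\<lambda>s. s ^ n *\<^sub>R v) t
          = (t powr (p + real n) / Gamma (p + real n + 1)) *\<^sub>R (Gamma (real n + 1) *\<^sub>R v)"
  using frac_integral_monomial[OF assms, of n "Gamma (real n + 1) *\<^sub>R v"]
    Gamma_real_pos[of "real n + 1"] by (simp add: less_imp_neq[symmetric])

lemma continuous_on_frac_integral:
  fixes f :: "real \<Rightarrow> 'a::euclidean_space"
  assumes "p \<ge> 0" "continuous_on {0..T} f"
  shows "continuous_on {0..T} (frac_integral p f)"
proof (cases "p = 0")
  case True
  then show ?thesis using assms by (simp add: frac_integral_def[abs_def])
next
  case False
  then have p: "p > 0" using assms by simp
  from assms(2) show ?thesis
  proof (induction f rule: continuous_on_monomial_induct)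
    case (monomial n v)
    have "continuous_on {0..T} (\<lambda>t. (t powr (p + real n) / Gamma (p + real n + 1)) *\<^sub>R (Gamma (real n + 1) *\<^sub>R v))"
      using p by (intro continuous_intros continuous_on_powr') (auto simp: Gamma_eq_zero_iff)
    then show ?case
      by (rule continuous_on_eq) (use p in \<open>simp add: frac_integral_power_scaled\<close>)
  next
    case (add f g)
    have "continuous_on {0..T} (\<lambda>t. frac_integral p f t + frac_integral p g t)"
      by (intro continuous_on_add add)
    then show ?case
    proof (rule continuous_on_eq)
      fix t assume t: "t \<in> {0..T}"
      show "frac_integral p f t + frac_integral p g t = frac_integral p (\<lambda>t. f t + g t) t"
        by (rule frac_integral_add[symmetric])
           (use t p add continuous_on_subset[of "{0..T}" _ "{0..t}"] in auto)
    qed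
  next
    case (limit f)
    have "\<exists>g. continuous_on {0..T} g \<and> continuous_on {0..T} (frac_integral p g) \<and>
        (\<forall>t\<in>{0..T}. norm (f t - g t) \<le> inverse (real (Suc n)))" for n
      by (rule limit) simp
    then obtain g where g: "\<And>n. continuous_on {0..T} (g n)"
        "\<And>n. continuous_on {0..T} (frac_integral p (g n))"
        "\<And>n t. t \<in> {0..T} \<Longrightarrow> norm (f t - g n t) \<le> inverse (real (Suc n))"
      by metis
    have "uniform_limit {0..T} (\<lambda>n. frac_integral p (g n)) (frac_integral p f) sequentially"
      unfolding uniform_limit_iff
    proof (intro allI impI)
      fix e :: real assume "e > 0"
      have "(\<lambda>n. T powr p / Gamma (p + 1) * inverse (real (Suc n))) \<longlonglongrightarrow> T powr p / Gamma (p + 1) * 0"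
        by (intro tendsto_intros LIMSEQ_inverse_real_of_nat)
      then have "\<forall>\<^sub>F n in sequentially. T powr p / Gamma (p + 1) * inverse (real (Suc n)) < e"
        using \<open>e > 0\<close> by (intro order_tendstoD(2)) auto
      then show "\<forall>\<^sub>F n in sequentially. \<forall>t\<in>{0..T}. dist (frac_integral p (g n) t) (frac_integral p f t) < e"
      proof eventually_elim
        case (elim n)
        show ?case
        proof
          fix t assume "t \<in> {0..T}"
          then have "norm (frac_integral p f t - frac_integral p (g n) t)
              \<le> T powr p / Gamma (p + 1) * inverse (real (Suc n))"
            by (intro frac_integral_diff_bound p limit g)
          then show "dist (frac_integral p (g n) t) (frac_integral p f t) < e"
            using elim by (simp add: dist_norm norm_minus_commute)
        qed
      qed
    qed
    then show ?case
      by (rule uniform_limit_theorem[rotated]) (auto simp: g)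
  qed
qed

lemma frac_integral_semigroup:
  fixes f :: "real \<Rightarrow> 'a::euclidean_space"
  assumes "p \<ge> 0" "q \<ge> 0" "continuous_on {0..T} f" "t \<in> {0..T}"
  shows "frac_integral p (frac_integral q f) t = frac_integral (p + q) f t"
proof (cases "p = 0 \<or> q = 0")
  case True
  have "frac_integral 0 h = h" for h :: "real \<Rightarrow> 'a"
    by (simp add: frac_integral_def fun_eq_iff)
  then show ?thesis using True by auto
next
  case False
  then have pq: "p > 0" "q > 0" using assms by auto
  from assms(3,4) show ?thesis
  proof (induction f arbitrary: t rule: continuous_on_monomial_induct)
    case (monomial n v)
    then have t: "t \<ge> 0" by simp
    define w where "w = Gamma (real n + 1) *\<^sub>R v"
    have "frac_integral p (frac_integral q (\<lambda>t. t ^ n *\<^sub>R v)) t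
        = frac_integral p (\<lambda>s. (s powr (q + real n) / Gamma (q + real n + 1)) *\<^sub>R w) t"
      unfolding w_def by (rule frac_integral_cong) (use pq t frac_integral_power_scaled in auto)
    also have "\<dots> = (t powr (p + (q + real n)) / Gamma (p + (q + real n) + 1)) *\<^sub>R w"
      using pq t by (intro frac_integral_powr) auto
    also have "\<dots> = frac_integral (p + q) (\<lambda>t. t ^ n *\<^sub>R v) t"
      using pq t by (simp add: frac_integral_power_scaled w_def add.assoc)
    finally show ?case .
  next
    case (add f g)
    have sub: "{0..s} \<subseteq> {0..T}" if "s \<in> {0..T}" for s using that by auto
    note cont = continuous_on_subset[OF add(1) sub] continuous_on_subset[OF add(2) sub]
    have I: "continuous_on {0..t} (frac_integral q h)" if "continuous_on {0..T} h" for h :: "real \<Rightarrow> 'a"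
      using continuous_on_frac_integral[of q T h] that pq add.prems
      by (auto intro: continuous_on_subset)
    have "frac_integral p (frac_integral q (\<lambda>t. f t + g t)) t
       = frac_integral p (\<lambda>s. frac_integral q f s + frac_integral q g s) t"
      using add.prems pq
      by (intro frac_integral_cong frac_integral_add cont) auto
    also have "\<dots> = frac_integral p (frac_integral q f) t + frac_integral p (frac_integral q g) t"
      using pq add.prems by (intro frac_integral_add I add) auto
    also have "\<dots> = frac_integral (p + q) f t + frac_integral (p + q) g t"
      using add by simp
    also have "\<dots> = frac_integral (p + q) (\<lambda>t. f t + g t) t"
      using pq add.prems by (intro frac_integral_add[symmetric] cont) auto
    finally show ?case .
  next
    case (limit f)
    \<comment> \<open>Both sides are Lipschitz in \<open>f\<close>, so their difference is at most a fixed multiple of any approximation error.\<close>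
    define K where "K = T powr p / Gamma (p + 1) * (T powr q / Gamma (q + 1))
        + T powr (p + q) / Gamma (p + q + 1)"
    have K: "norm (frac_integral p (frac_integral q f) t - frac_integral (p + q) f t) \<le> K * e"
      if e_pos: "e > 0" for e
    proof -
      obtain g where g: "continuous_on {0..T} g" "\<And>t. t \<in> {0..T} \<Longrightarrow> norm (f t - g t) \<le> e"
         "\<And>t. t \<in> {0..T} \<Longrightarrow> frac_integral p (frac_integral q g) t = frac_integral (p + q) g t"
        using limit(2)[OF e_pos] by metis
      have "norm (frac_integral p (frac_integral q f) t - frac_integral p (frac_integral q g) t)
          \<le> T powr p / Gamma (p + 1) * (T powr q / Gamma (q + 1) * e)"
        using pq g limit by (intro frac_integral_diff_bound continuous_on_frac_integral) auto
      moreover have "norm (frac_integral (p + q) f t - frac_integral (p + q) g t)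
          \<le> T powr (p + q) / Gamma (p + q + 1) * e"
        using pq g limit by (intro frac_integral_diff_bound) auto
      moreover have "frac_integral p (frac_integral q g) t = frac_integral (p + q) g t"
        using g limit by auto
      ultimately show ?thesis
        using norm_triangle_ineq4[of "frac_integral p (frac_integral q f) t - frac_integral p (frac_integral q g) t"
          "frac_integral (p + q) f t - frac_integral (p + q) g t"]
        by (simp add: K_def algebra_simps)
    qed
    have "((\<lambda>e. K * e) \<longlongrightarrow> K * 0) (at_right 0)"
      by (intro tendsto_intros)
    moreover have "\<forall>\<^sub>F e in at_right 0.
        norm (frac_integral p (frac_integral q f) t - frac_integral (p + q) f t) \<le> K * e"
      using K by (auto simp: eventually_at_right_less intro!: eventually_at_rightI[of 0 1])
    ultimately have "norm (frac_integral p (frac_integral q f) t - frac_integral (p + q) f t) \<le> K * 0"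
      by (intro tendsto_lowerbound) auto
    then show ?case by simp
  qed
qed

lemma frac_integral_one_derivative:
  fixes f f' :: "real \<Rightarrow> 'a::euclidean_space"
  assumes "\<And>s. s \<in> {0..T} \<Longrightarrow> (f has_vector_derivative f' s) (at s within {0..T})" "t \<in> {0..T}"
  shows "frac_integral 1 f' t = f t - f 0"
proof -
  have "(f' has_integral (f t - f 0)) {0..t}"
    using assms
    by (intro fundamental_theorem_of_calculus)
       (auto intro: has_vector_derivative_within_subset[where S = "{0..T}"])
  then have "((\<lambda>s. (t - s) powr (1 - 1) *\<^sub>R f' s) has_integral (f t - f 0)) {0..t}"
    by (rule has_integral_spike[of "{t}", rotated 2]) auto
  then show ?thesis by (simp add: frac_integral_def integral_unique)
qed

section \<open>The coefficient matrices\<close>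

lemma bounded_bilinear_matrix_mult:
  "bounded_bilinear ((**) :: real^'n^'n \<Rightarrow> real^'n^'n \<Rightarrow> real^'n^'n)"
  unfolding bilinear_conv_bounded_bilinear[symmetric] bilinear_def
  by (auto intro!: linearI simp: matrix_matrix_mult_def vec_eq_iff algebra_simps sum.distrib sum_distrib_left)

lemma bounded_bilinear_matrix_vector_mult:
  "bounded_bilinear ((*v) :: real^'n^'n \<Rightarrow> real^'n \<Rightarrow> real^'n)"
  unfolding bilinear_conv_bounded_bilinear[symmetric] bilinear_def
  by (auto intro!: linearI simp: matrix_vector_mult_def vec_eq_iff algebra_simps sum.distrib sum_distrib_left)

interpretation mm: bounded_bilinear "(**) :: real^'n^'n \<Rightarrow> real^'n^'n \<Rightarrow> real^'n^'n"
  by (rule bounded_bilinear_matrix_mult)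

interpretation mv: bounded_bilinear "(*v) :: real^'n^'n \<Rightarrow> real^'n \<Rightarrow> real^'n"
  by (rule bounded_bilinear_matrix_vector_mult)

text \<open>
  \<open>Q_matrix A B k m\<close> is the sum of all words with \<open>k\<close> letters \<open>A\<close> and \<open>m\<close> letters \<open>B\<close>; the defining
  formula sorts these words by the position of their first \<open>B\<close>. The recursions \<open>Q_matrix_left\<close> and
  \<open>Q_matrix_right\<close> below sort them by their first and their last letter.
\<close>

lemma Q_matrix_Suc_eq:
  "Q_matrix A B k (Suc m) = (\<Sum>l\<le>k. matrix_power A (k - l) ** B ** Q_matrix A B l m)"
  by (cases k; cases m) auto

lemma Q_matrix_left_Suc_0: "Q_matrix A B (Suc k) 0 = A ** Q_matrix A B k 0"
  and Q_matrix_left_0_Suc: "Q_matrix A B 0 (Suc m) = B ** Q_matrix A B 0 m"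
  by (simp_all, cases m, simp_all)

lemma Q_matrix_left:
  "Q_matrix A B (Suc k) (Suc m) = A ** Q_matrix A B k (Suc m) + B ** Q_matrix A B (Suc k) m"
proof -
  have "A ** Q_matrix A B k (Suc m) = (\<Sum>l\<le>k. matrix_power A (Suc k - l) ** B ** Q_matrix A B l m)"
    unfolding Q_matrix_Suc_eq mm.sum_right
    by (intro sum.cong refl) (simp add: Suc_diff_le matrix_mul_assoc)
  then show ?thesis
    unfolding Q_matrix_Suc_eq[of A B "Suc k"] by simp
qed

lemma matrix_power_right: "matrix_power A (Suc k) = matrix_power A k ** A"
proof (induction k)
  case (Suc k)
  have "matrix_power A (Suc (Suc k)) = A ** (matrix_power A k ** A)"
    using Suc by simp
  then show ?case by (simp add: matrix_mul_assoc)
qed simp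

lemma Q_matrix_right_Suc_0: "Q_matrix A B (Suc k) 0 = Q_matrix A B k 0 ** A"
  using matrix_power_right[of A k] by simp

lemma Q_matrix_right_0_Suc: "Q_matrix A B 0 (Suc m) = Q_matrix A B 0 m ** B"
  using matrix_power_right[of B m] by (cases m) simp_all

text \<open>
  Expand the first letter, then the last letter of each remaining word by induction, and
  reassemble the words according to their last letter. The auxiliary \<open>X\<close> and \<open>Y\<close> stand for coefficient
  matrices that are zero when an index would be negative.
\<close>

lemma Q_matrix_right:
  "Q_matrix A B (Suc k) (Suc m) = Q_matrix A B k (Suc m) ** A + Q_matrix A B (Suc k) m ** B"
proof (induction "k + m" arbitrary: k m rule: less_induct)
  case less
  define X where "X = (if k = 0 then 0 else Q_matrix A B (k - 1) (Suc m))"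
  define Y where "Y = (if m = 0 then 0 else Q_matrix A B (Suc k) (m - 1))"
  have 1: "Q_matrix A B k (Suc m) = X ** A + Q_matrix A B k m ** B"
    by (cases k) (use less[of "k - 1" m] in \<open>auto simp: X_def Q_matrix_right_0_Suc mm.zero_left simp del: Q_matrix.simps\<close>)
  have 2: "Q_matrix A B (Suc k) m = Q_matrix A B k m ** A + Y ** B"
    by (cases m) (use less[of k "m - 1"] in \<open>auto simp: Y_def Q_matrix_right_Suc_0 mm.zero_left simp del: Q_matrix.simps\<close>)
  have 3: "Q_matrix A B k (Suc m) = A ** X + B ** Q_matrix A B k m"
    by (cases k) (auto simp: X_def Q_matrix_left_0_Suc Q_matrix_left mm.zero_right simp del: Q_matrix.simps)
  have 4: "Q_matrix A B (Suc k) m = A ** Q_matrix A B k m + B ** Y"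
    by (cases m) (auto simp: Y_def Q_matrix_left_Suc_0 Q_matrix_left mm.zero_right simp del: Q_matrix.simps)
  have "Q_matrix A B (Suc k) (Suc m)
      = A ** (X ** A + Q_matrix A B k m ** B) + B ** (Q_matrix A B k m ** A + Y ** B)"
    unfolding Q_matrix_left 1[symmetric] 2[symmetric] ..
  also have "\<dots> = (A ** X + B ** Q_matrix A B k m) ** A + (A ** Q_matrix A B k m + B ** Y) ** B"
    by (simp add: mm.add_left mm.add_right matrix_mul_assoc)
  also have "\<dots> = Q_matrix A B k (Suc m) ** A + Q_matrix A B (Suc k) m ** B"
    unfolding 3[symmetric] 4[symmetric] ..
  finally show ?case .
qed

text \<open>
  Matrix multiplication is submultiplicative only up to a constant for the norm of this type; \<open>L\<close>
  absorbs that constant, and the factor \<open>2\<close> comes from the two summands of \<open>Q_matrix_right\<close>.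
\<close>

lemma norm_Q_matrix_le:
  fixes A B :: "real^'n^'n"
  obtains L where "L > 0" "\<And>k m. norm (Q_matrix A B k m) \<le> norm (mat 1 :: real^'n^'n) * (2 * L) ^ (k + m)"
proof -
  obtain K where K: "K > 0" "\<And>(X :: real^'n^'n) (Y :: real^'n^'n). norm (X ** Y) \<le> norm X * norm Y * K"
    using bounded_bilinear.pos_bounded[OF bounded_bilinear_matrix_mult[where 'n = 'n]] by blast
  define L where "L = (norm A + norm B + 1) * K"
  have "L > 0" using K by (auto simp: L_def intro!: mult_pos_pos add_nonneg_pos)
  have LA: "norm (X ** A) \<le> norm X * L" and LB: "norm (X ** B) \<le> norm X * L" for X :: "real^'n^'n"
  proof -
    have "norm X * norm A * K \<le> norm X * L" "norm X * norm B * K \<le> norm X * L"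
      using K(1) unfolding L_def mult.assoc by (auto intro!: mult_left_mono mult_right_mono)
    then show "norm (X ** A) \<le> norm X * L" "norm (X ** B) \<le> norm X * L"
      using K(2)[of X A] K(2)[of X B] by linarith+
  qed
  define N where "N = norm (mat 1 :: real^'n^'n)"
  have *: "norm X * L \<le> N * (2 * L) ^ Suc j" if "norm X \<le> N * (2 * L) ^ j" for X :: "real^'n^'n" and j
  proof -
    have "norm X * L \<le> (N * (2 * L) ^ j) * (2 * L)"
      using that \<open>L > 0\<close> by (intro mult_mono) (auto simp: N_def)
    then show ?thesis by (simp add: mult_ac)
  qed
  have "norm (Q_matrix A B k m) \<le> N * (2 * L) ^ (k + m)" for k m
  proof (induction "k + m" arbitrary: k m rule: less_induct)
    case less
    show ?case
    proof (cases k; cases m)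
      assume "k = 0" "m = 0"
      then show ?thesis by (simp add: N_def)
    next
      fix m' assume km: "k = 0" "m = Suc m'"
      then have "norm (Q_matrix A B 0 m' ** B) \<le> N * (2 * L) ^ Suc m'"
        using less[of 0 m'] by (intro order_trans[OF LB *]) auto
      then show ?thesis unfolding km Q_matrix_right_0_Suc by simp
    next
      fix k' assume km: "k = Suc k'" "m = 0"
      then have "norm (Q_matrix A B k' 0 ** A) \<le> N * (2 * L) ^ Suc k'"
        using less[of k' 0] by (intro order_trans[OF LA *]) auto
      then show ?thesis unfolding km Q_matrix_right_Suc_0 by simp
    next
      fix k' m' assume km: "k = Suc k'" "m = Suc m'"
      have "norm (Q_matrix A B k' (Suc m')) \<le> N * (2 * L) ^ Suc (k' + m')"
           "norm (Q_matrix A B (Suc k') m') \<le> N * (2 * L) ^ Suc (k' + m')"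
        using less[of k' "Suc m'"] less[of "Suc k'" m'] km by auto
      then have "norm (Q_matrix A B k' (Suc m')) * L + norm (Q_matrix A B (Suc k') m') * L
          \<le> N * (2 * L) ^ Suc (k' + m') * L + N * (2 * L) ^ Suc (k' + m') * L"
        using \<open>L > 0\<close> by (intro add_mono mult_right_mono) auto
      also have "\<dots> = N * (2 * L) ^ (k + m)"
        by (simp add: km algebra_simps)
      finally have "norm (Q_matrix A B k' (Suc m')) * L + norm (Q_matrix A B (Suc k') m') * L
          \<le> N * (2 * L) ^ (k + m)" .
      then show ?thesis
        using norm_triangle_ineq[of "Q_matrix A B k' (Suc m') ** A" "Q_matrix A B (Suc k') m' ** B"]
          LA[of "Q_matrix A B k' (Suc m')"] LB[of "Q_matrix A B (Suc k') m'"]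
        unfolding km Q_matrix_right by linarith
    qed
  qed
  with \<open>L > 0\<close> show ?thesis using that by (auto simp: N_def)
qed

section \<open>Convergence of the double series\<close>

text \<open>
  Faster than geometric growth, with an arbitrary base \<open>R\<close>: restrict Euler's integral to
  \<open>{R..R + 1}\<close>, where the integrand is at least the left-hand side.
\<close>

lemma Gamma_real_lower_bound:
  fixes R x :: real
  assumes "R > 0" "x \<ge> 1"
  shows "R powr (x - 1) * exp (- (R + 1)) \<le> Gamma x"
proof -
  have G: "((\<lambda>t. t powr (x - 1) / exp t) has_integral Gamma x) {0..}"
    using assms by (intro Gamma_integral_real) auto
  have "((\<lambda>t. R powr (x - 1) * exp (- (R + 1))) has_integral
      Henstock_Kurzweil_Integration.content {R..R + 1} *\<^sub>R (R powr (x - 1) * exp (- (R + 1)))) {R..R + 1}"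
    by (rule has_integral_const_real)
  then have "((\<lambda>t. R powr (x - 1) * exp (- (R + 1))) has_integral
      R powr (x - 1) * exp (- (R + 1))) {R..R + 1}"
    by simp
  moreover have "{R..R + 1} \<subseteq> {0..}" using assms by auto
  ultimately have C: "((\<lambda>t. if t \<in> {R..R + 1} then R powr (x - 1) * exp (- (R + 1)) else 0) has_integral
      R powr (x - 1) * exp (- (R + 1))) {0..}"
    by (simp only: has_integral_restrict)
  show ?thesis
  proof (rule has_integral_le[OF C G])
    fix t :: real assume "t \<in> {0..}"
    show "(if t \<in> {R..R + 1} then R powr (x - 1) * exp (- (R + 1)) else 0) \<le> t powr (x - 1) / exp t"
      unfolding divide_inverse exp_minus[symmetric]
      using assms by (auto intro!: mult_mono powr_mono2)
  qed
qed

text \<open>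
  The terms of the Mittag-Leffler series multiplied by \<open>t powr d\<close>, the form in which all
  series of the solution formula appear.
\<close>

definition ml_term :: "real^'n^'n \<Rightarrow> real^'n^'n \<Rightarrow> real \<Rightarrow> real \<Rightarrow> real \<Rightarrow> real \<Rightarrow> real \<Rightarrow> nat \<Rightarrow> nat \<Rightarrow> real^'n^'n"
  where "ml_term A B a b c d t k m =
    (t powr (real k * a + real m * b + d) / Gamma (real k * a + real m * b + c)) *\<^sub>R Q_matrix A B k m"

lemma ml_term_0: "ml_term A B a b c 0 = mittag_leffler_term A B a b c"
  by (simp add: fun_eq_iff ml_term_def mittag_leffler_term_def)

text \<open>
  The norm of the coefficient grows at most like \<open>(2 * L) ^ (k + m)\<close>. Choosing the base \<open>R = T * X\<close> in the lower
  bound for Gamma, with \<open>X\<close> so large that \<open>X powr a\<close> and \<open>X powr b\<close> are at least \<open>4 * L\<close>, leaves a product of two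
  geometric sequences, uniformly for \<open>t\<close> in \<open>{0..T}\<close>.
\<close>

lemma ml_term_bound:
  fixes A B :: "real^'n^'n"
  assumes "a > 0" "b > 0" "T > 0" "c \<ge> 1" "d \<ge> 0"
  obtains C where "C \<ge> 0"
    "\<And>k m t. t \<in> {0..T} \<Longrightarrow> norm (ml_term A B a b c d t k m) \<le> C * ((1/2) ^ k * (1/2) ^ m)"
proof -
  obtain L where L: "L > 0" "\<And>k m. norm (Q_matrix A B k m) \<le> norm (mat 1 :: real^'n^'n) * (2 * L) ^ (k + m)"
    using norm_Q_matrix_le by blast
  define N where "N = norm (mat 1 :: real^'n^'n)"
  define X where "X = max 1 (max ((4 * L) powr (1 / a)) ((4 * L) powr (1 / b)))"
  have X: "X \<ge> 1" by (simp add: X_def)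
  have Xlarge: "4 * L \<le> X powr e" if "(4 * L) powr (1 / e) \<le> X" "e > 0" for e
  proof -
    have "((4 * L) powr (1 / e)) powr e \<le> X powr e" using that by (intro powr_mono2) auto
    then show ?thesis using that L by (simp add: powr_powr)
  qed
  have half: "2 * L * X powr (- e) \<le> 1 / 2" if "(4 * L) powr (1 / e) \<le> X" "e > 0" for e
    using Xlarge[OF that] X by (simp add: powr_minus field_simps)
  have halfa: "2 * L * X powr (- a) \<le> 1 / 2" and halfb: "2 * L * X powr (- b) \<le> 1 / 2"
    using assms by (intro half; simp add: X_def)+
  define R where "R = T * X"
  have R: "R > 0" using assms X by (simp add: R_def)
  define C where "C = N * T powr d * R powr (1 - c) * exp (R + 1)"
  have "C \<ge> 0" by (simp add: C_def N_def)
  moreover have "norm (ml_term A B a b c d t k m) \<le> C * ((1/2) ^ k * (1/2) ^ m)" if t: "t \<in> {0..T}" for k m t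
  proof -
    define p where "p = real k * a + real m * b"
    have p: "p \<ge> 0" using assms by (simp add: p_def)
    have G: "R powr (p + c - 1) * exp (- (R + 1)) \<le> Gamma (p + c)"
      using Gamma_real_lower_bound[of R "p + c"] R p assms by simp
    have pos: "R powr (p + c - 1) * exp (- (R + 1)) > 0" using R by simp
    have "norm ((t powr (p + d) / Gamma (p + c)) *\<^sub>R Q_matrix A B k m)
        = t powr (p + d) / Gamma (p + c) * norm (Q_matrix A B k m)"
      using G pos by simp
    also have "\<dots> \<le> T powr (p + d) / (R powr (p + c - 1) * exp (- (R + 1))) * (N * (2 * L) ^ (k + m))"
      using G pos t p assms L(2)[of k m]
      by (intro mult_mono frac_le powr_mono2) (auto simp: N_def)
    also have "\<dots> = C * (((2 * L) ^ k * X powr (- (real k * a))) * ((2 * L) ^ m * X powr (- (real m * b))))"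
    proof -
      have "R powr (p + c - 1) = T powr p * X powr p * R powr (c - 1)"
        using assms X by (simp add: powr_add R_def powr_mult[symmetric] add_diff_eq[symmetric])
      moreover have "X powr p = X powr (real k * a) * X powr (real m * b)"
        by (simp add: p_def powr_add)
      ultimately show ?thesis
        using R assms X powr_minus[of R "c - 1"] powr_minus[of X "real k * a"] powr_minus[of X "real m * b"]
        by (simp add: C_def powr_add exp_minus power_add field_simps exp_add[symmetric])
    qed
    also have "\<dots> = C * ((2 * L * X powr (- a)) ^ k * (2 * L * X powr (- b)) ^ m)"
    proof -
      have "X powr (- (real k * a)) = (X powr (- a)) ^ k" "X powr (- (real m * b)) = (X powr (- b)) ^ m"
        using X by (auto simp: powr_realpow[symmetric] powr_powr mult.commute)
      then show ?thesis by (simp add: power_mult_distrib)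
    qed
    also have "\<dots> \<le> C * ((1/2) ^ k * (1/2) ^ m)"
      using halfa halfb \<open>C \<ge> 0\<close> L(1)
      by (intro mult_left_mono mult_mono power_mono) (auto intro!: mult_nonneg_nonneg)
    finally show ?thesis by (simp add: p_def ml_term_def)
  qed
  ultimately show ?thesis using that by blast
qed

text \<open>
  Unconditional summability lets the iterated sum be rearranged along the diagonals \<open>k + m = n\<close>, the
  order in which the Neumann series produces its terms.
\<close>

lemma geometric_double_series:
  fixes f :: "nat \<Rightarrow> nat \<Rightarrow> 'a::banach"
  assumes "\<And>k m. norm (f k m) \<le> C * ((1/2) ^ k * (1/2) ^ m)"
  shows double_summable_geometric: "double_summable f"
    and diagonal_sums_double_suminf: "(\<lambda>n. \<Sum>k\<le>n. f k (n - k)) sums double_suminf f"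
proof -
  have geo: "((\<lambda>k. (1/2 :: real) ^ k) has_sum 2) (UNIV :: nat set)" 
  proof (rule sums_nonneg_imp_has_sum)
    show "(\<lambda>k. (1/2 :: real) ^ k) sums 2"
      using geometric_sums[of "1/2::real"] by simp
  qed simp
  have row_geo: "((\<lambda>m. case (k, m) of (k, m) \<Rightarrow> C * ((1/2) ^ k * (1/2) ^ m)) has_sum (C * ((1/2) ^ k * 2))) (UNIV :: nat set)" for k :: nat
    by (simp add: has_sum_cmult_right geo)
  have "(\<lambda>k. C * ((1/2) ^ k * 2)) summable_on (UNIV :: nat set)"
    using geo by (intro summable_on_cmult_right summable_on_cmult_left has_sum_imp_summable)
  moreover have "C \<ge> 0" using order_trans[OF norm_ge_zero assms[of 0 0]] by simp
  ultimately have "(\<lambda>(k, m). C * ((1/2) ^ k * (1/2) ^ m)) summable_on (UNIV :: nat set) \<times> (UNIV :: nat set)"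
    using row_geo by (intro summable_on_SigmaI) auto
  then have "(\<lambda>z. norm ((\<lambda>(k, m). f k m) z)) summable_on UNIV \<times> UNIV"
    by (rule Infinite_Sum.abs_summable_on_comparison_test') (use assms in auto)
  then have summ: "(\<lambda>(k, m). f k m) summable_on UNIV \<times> UNIV"
    by (rule abs_summable_summable)
  then obtain S where S: "((\<lambda>(k, m). f k m) has_sum S) (UNIV \<times> UNIV)"
    by (auto simp: summable_on_def)
  have row: "f k summable_on UNIV" for k
  proof -
    have "(\<lambda>m. C * ((1/2) ^ k * (1/2) ^ m)) summable_on (UNIV :: nat set)"
      using has_sum_imp_summable[OF row_geo[of k]] by simp
    then have "(\<lambda>m. norm (f k m)) summable_on UNIV"
      by (rule Infinite_Sum.abs_summable_on_comparison_test') (use assms in auto)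
    then show ?thesis by (rule abs_summable_summable)
  qed
  then have row_sum: "(f k has_sum (\<Sum>m. f k m)) UNIV" for k
    using has_sum_imp_sums sums_unique by (metis has_sum_infsum)
  have outer: "((\<lambda>k. \<Sum>m. f k m) has_sum S) UNIV"
    by (rule has_sum_SigmaD[OF S]) (simp add: row_sum)
  then show "double_summable f"
    using row summable_on_imp_summable by (auto simp: double_summable_def summable_on_def)
  have S_eq: "S = double_suminf f"
    unfolding double_suminf_def using has_sum_imp_sums[OF outer] by (simp add: sums_iff)
  have bij: "bij_betw (\<lambda>(n, k). (k, n - k)) (SIGMA n:(UNIV :: nat set). {..n}) (UNIV \<times> UNIV)"
    by (rule bij_betw_byWitness[where f' = "\<lambda>(k, m). (k + m, k)"]) auto
  have "((\<lambda>(n, k). f k (n - k)) has_sum S) (SIGMA n:UNIV. {..n})"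
    using has_sum_reindex_bij_betw[OF bij, of "\<lambda>(k, m). f k m" S] S by (simp add: case_prod_unfold)
  then have "((\<lambda>n. \<Sum>k\<le>n. f k (n - k)) has_sum S) UNIV"
    by (rule has_sum_SigmaD) simp
  then show "(\<lambda>n. \<Sum>k\<le>n. f k (n - k)) sums double_suminf f"
    unfolding S_eq by (rule has_sum_imp_sums)
qed

lemma double_summable_bounded_linear:
  assumes "bounded_linear h" "double_summable f"
  shows "double_summable (\<lambda>k m. h (f k m))"
    and "double_suminf (\<lambda>k m. h (f k m)) = h (double_suminf f)"
proof -
  have row: "\<And>k. summable (f k)" and outer: "summable (\<lambda>k. \<Sum>m. f k m)"
    using assms(2) by (auto simp: double_summable_def)
  have eq: "(\<Sum>m. h (f k m)) = h (\<Sum>m. f k m)" for k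
    by (rule bounded_linear.suminf[OF assms(1) row, symmetric])
  show "double_summable (\<lambda>k m. h (f k m))"
    unfolding double_summable_def eq
    by (intro conjI allI bounded_linear.summable[OF assms(1)] row outer)
  show "double_suminf (\<lambda>k m. h (f k m)) = h (double_suminf f)"
    unfolding double_suminf_def eq by (rule bounded_linear.suminf[OF assms(1) outer, symmetric])
qed

section \<open>The Neumann series of the Volterra equation\<close>

text \<open>
  One step of the Neumann iteration: by \<open>Q_matrix_right\<close>, applying the diagonal \<open>n\<close> of words to
  \<open>A v + B v\<close> with shifted indices gives the diagonal \<open>n + 1\<close>.
\<close>

lemma Q_matrix_diagonal_sum:
  fixes v :: "nat \<Rightarrow> nat \<Rightarrow> real^'n"
  shows "(\<Sum>k\<le>Suc n. Q_matrix A B k (Suc n - k) *v v k (Suc n - k))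
       = (\<Sum>k\<le>n. Q_matrix A B k (n - k) *v (A *v v (Suc k) (n - k) + B *v v k (Suc (n - k))))"
proof -
  define l where "l k m = (if k = 0 then 0 else (Q_matrix A B (k - 1) m ** A) *v v k m)" for k m
  define r where "r k m = (if m = 0 then 0 else (Q_matrix A B k (m - 1) ** B) *v v k m)" for k m
  have split: "Q_matrix A B k m *v v k m = l k m + r k m" if "k + m > 0" for k m
    using that
    by (cases k; cases m)
       (simp_all add: l_def r_def Q_matrix_right Q_matrix_right_0_Suc Q_matrix_right_Suc_0
          mv.add_left del: Q_matrix.simps)
  have "(\<Sum>k\<le>Suc n. Q_matrix A B k (Suc n - k) *v v k (Suc n - k))
      = (\<Sum>k\<le>Suc n. l k (Suc n - k)) + (\<Sum>k\<le>Suc n. r k (Suc n - k))"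
    unfolding sum.distrib[symmetric] by (intro sum.cong refl split) auto
  also have "(\<Sum>k\<le>Suc n. l k (Suc n - k)) = (\<Sum>k\<le>n. l (Suc k) (n - k))"
    unfolding sum.atMost_Suc_shift by (simp add: l_def)
  also have "(\<Sum>k\<le>Suc n. r k (Suc n - k)) = (\<Sum>k\<le>n. r k (Suc (n - k)))"
    by (simp add: r_def Suc_diff_le)
  also have "(\<Sum>k\<le>n. l (Suc k) (n - k)) + (\<Sum>k\<le>n. r k (Suc (n - k)))
     = (\<Sum>k\<le>n. Q_matrix A B k (n - k) *v (A *v v (Suc k) (n - k) + B *v v k (Suc (n - k))))"
    unfolding sum.distrib[symmetric]
    by (intro sum.cong refl) (simp add: l_def r_def mv.add_right matrix_vector_mul_assoc)
  finally show ?thesis .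
qed

text \<open>
  The sum telescopes by the preceding lemma, and the remainder tends to zero as the term of a
  convergent series. With \<open>w k m\<close> the fractional integral of order \<open>k a + m b\<close> of a function \<open>z\<close>, the
  conclusion inverts the operator that sends \<open>z\<close> to \<open>z - A (I\<^sup>a z) - B (I\<^sup>b z)\<close>.
\<close>

lemma Q_matrix_neumann_sums:
  fixes w :: "nat \<Rightarrow> nat \<Rightarrow> real^'n"
  assumes "\<And>k m. norm (Q_matrix A B k m *v w k m) \<le> C * ((1/2) ^ k * (1/2) ^ m)"
  shows "(\<lambda>n. \<Sum>k\<le>n. Q_matrix A B k (n - k) *v
            (w k (n - k) - A *v w (Suc k) (n - k) - B *v w k (Suc (n - k)))) sums w 0 0"
proof -
  define D where "D n = (\<Sum>k\<le>n. Q_matrix A B k (n - k) *v w k (n - k))" for n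
  have "D \<longlonglongrightarrow> 0"
    unfolding D_def
    by (rule summable_LIMSEQ_zero[OF sums_summable[OF diagonal_sums_double_suminf[OF assms]]])
  from telescope_sums'[OF this] have "(\<lambda>n. D n - D (Suc n)) sums w 0 0"
    by (simp add: D_def)
  moreover have "D n - D (Suc n) = (\<Sum>k\<le>n. Q_matrix A B k (n - k) *v
            (w k (n - k) - A *v w (Suc k) (n - k) - B *v w k (Suc (n - k))))" for n
    unfolding D_def Q_matrix_diagonal_sum sum_subtractf[symmetric]
    by (simp add: mv.diff_right mv.add_right algebra_simps)
  ultimately show ?thesis by simp
qed

lemma frac_integral_const:
  fixes v :: "'a::euclidean_space"
  assumes "p \<ge> 0" "t > 0"
  shows "frac_integral p (\<lambda>s. v) t = (t powr p / Gamma (p + 1)) *\<^sub>R v"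
proof (cases "p = 0")
  case False
  then show ?thesis using frac_integral_monomial[of p t 0 v] assms by simp
qed (use assms in \<open>simp add: frac_integral_def\<close>)

lemma caputo_derivative_eq_frac_integral:
  assumes "real N - 1 < \<nu>" "\<nu> \<le> real N"
  shows "caputo_derivative J \<nu> y t = frac_integral (real N - \<nu>) (nth_deriv_within J N y) t"
proof -
  have "\<lceil>\<nu>\<rceil> = int N" using assms by (intro ceiling_unique) auto
  then show ?thesis by (simp add: caputo_derivative_def frac_integral_def)
qed

text \<open>
  Integrating the differential equation to the order \<open>p + \<alpha>\<close>. By the semigroup law the two Caputo derivatives become
  ordinary integrals of the second and the first derivative of \<open>y\<close>, up to a remaining fractional integral, so
  the fundamental theorem of calculus brings in the initial values. Here \<open>w p\<close> is the fractional
  integral of \<open>y - \<eta>\<close> of order \<open>p\<close>, and the last term on the right corrects for \<open>B\<close> acting on \<open>y\<close>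
  and not on \<open>y - \<eta>\<close>.
\<close>

lemma ivp_frac_integral:
  fixes A B :: "real^'n^'n"
  assumes "T > 0" "1 < \<alpha>" "\<alpha> \<le> 2" "0 < \<beta>" "\<beta> \<le> 1"
    and y: "continuously_differentiable_on 2 {0..T} y" "solves_ivp T \<alpha> \<beta> A B g \<eta> \<eta>' y"
    and t: "t \<in> {0<..T}" and p: "p \<ge> 0"
  defines "w \<equiv> \<lambda>q. frac_integral q y t - (t powr q / Gamma (q + 1)) *\<^sub>R \<eta>"
  shows "w p - A *v w (p + (\<alpha> - \<beta>)) - B *v w (p + \<alpha>)
       = frac_integral (p + \<alpha>) g t + (t powr (p + 1) / Gamma (p + 2)) *\<^sub>R \<eta>'
         + B *v ((t powr (p + \<alpha>) / Gamma (p + \<alpha> + 1)) *\<^sub>R \<eta>)"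
proof -
  define y1 where "y1 = nth_deriv_within {0..T} 1 y"
  define y2 where "y2 = nth_deriv_within {0..T} 2 y"
  have diff: "nth_deriv_within {0..T} j y differentiable_on {0..T}" if "j < 2" for j
    using y(1) that by (simp add: continuously_differentiable_on_def)
  have deriv: "(nth_deriv_within {0..T} j y has_vector_derivative nth_deriv_within {0..T} (Suc j) y s)
      (at s within {0..T})" if "j < 2" "s \<in> {0..T}" for j s
    using diff[OF that(1)] that(2)
    by (auto simp: differentiable_on_def vector_derivative_works)
  have cont: "continuous_on {0..T} y" "continuous_on {0..T} y1" "continuous_on {0..T} y2"
    using differentiable_imp_continuous_on[OF diff[of 0]] differentiable_imp_continuous_on[OF diff[of 1]]
      y(1) by (auto simp: y1_def y2_def continuously_differentiable_on_def)
  have init: "y 0 = \<eta>" "y1 0 = \<eta>'"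
    using y(2) by (auto simp: solves_ivp_def y1_def)
  have I1: "frac_integral 1 y1 s = y s - \<eta>" if "s \<in> {0..T}" for s
    using frac_integral_one_derivative[of T y y1 s] deriv[of 0] that by (simp add: y1_def init)
  have I2: "frac_integral 1 y2 s = y1 s - \<eta>'" if "s \<in> {0..T}" for s
    using frac_integral_one_derivative[of T y1 y2 s] deriv[of 1] that init(2)
    by (simp add: y1_def y2_def numeral_2_eq_2)
  have tT: "t \<in> {0..T}" "t > 0" "t \<ge> 0" "{0..t} \<subseteq> {0..T}" using t by auto
  have sub: "continuous_on {0..t} h" if "continuous_on {0..T} h" for h :: "real \<Rightarrow> real^'n"
    using that tT(4) by (rule continuous_on_subset)
  have J1: "frac_integral (q + 1) y1 t = w q" if "q \<ge> 0" for q
  proof -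
    have "frac_integral (q + 1) y1 t = frac_integral q (frac_integral 1 y1) t"
      using that tT cont by (intro frac_integral_semigroup[symmetric]) auto
    also have "\<dots> = frac_integral q (\<lambda>s. y s - \<eta>) t"
      using tT by (intro frac_integral_cong I1) auto
    also have "\<dots> = w q"
      using that tT sub cont by (simp add: frac_integral_diff frac_integral_const w_def)
    finally show ?thesis .
  qed
  have J2: "frac_integral (p + 2) y2 t = w p - (t powr (p + 1) / Gamma (p + 2)) *\<^sub>R \<eta>'"
  proof -
    have "frac_integral (p + 2) y2 t = frac_integral (p + 1 + 1) y2 t"
      by (simp add: add.assoc)
    also have "\<dots> = frac_integral (p + 1) (frac_integral 1 y2) t"
      using p tT cont by (intro frac_integral_semigroup[symmetric]) auto
    also have "\<dots> = frac_integral (p + 1) (\<lambda>s. y1 s - \<eta>') t"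
      using tT by (intro frac_integral_cong I2) auto
    also have "\<dots> = frac_integral (p + 1) y1 t - (t powr (p + 1) / Gamma (p + 1 + 1)) *\<^sub>R \<eta>'"
      using p tT sub cont by (simp add: frac_integral_diff frac_integral_const)
    finally show ?thesis using J1[OF p] by (simp add: add.assoc)
  qed
  define Da where "Da = frac_integral (2 - \<alpha>) y2"
  define Db where "Db = frac_integral (1 - \<beta>) y1"
  have contD: "continuous_on {0..t} Da" "continuous_on {0..t} Db"
    unfolding Da_def Db_def using assms cont by (intro sub continuous_on_frac_integral; simp)+
  have cont': "continuous_on {0..t} (\<lambda>s. A *v Db s)" "continuous_on {0..t} (\<lambda>s. B *v y s)"
    using contD sub[OF cont(1)] by (auto intro: matrix_vector_mult_linear_continuous_on
      continuous_on_compose2[OF matrix_vector_mult_linear_continuous_on])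
  have g: "g s = Da s - A *v Db s - B *v y s" if "s \<in> {0<..t}" for s
  proof -
    have "s \<in> {0<..T}" using that tT by auto
    then have "caputo_derivative {0..T} \<alpha> y s - A *v caputo_derivative {0..T} \<beta> y s - B *v y s = g s"
      using y(2) by (simp only: solves_ivp_def)
    moreover have "caputo_derivative {0..T} \<alpha> y s = Da s"
      using caputo_derivative_eq_frac_integral[of 2 \<alpha> "{0..T}" y s] assms
      by (simp add: Da_def y2_def)
    moreover have "caputo_derivative {0..T} \<beta> y s = Db s"
      using caputo_derivative_eq_frac_integral[of 1 \<beta> "{0..T}" y s] assms
      by (simp add: Db_def y1_def)
    ultimately show ?thesis by simp
  qed
  have "frac_integral (p + \<alpha>) g t = frac_integral (p + \<alpha>) (\<lambda>s. Da s - A *v Db s - B *v y s) t"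
    using p assms by (intro frac_integral_cong_Ioc g) auto
  also have "\<dots> = frac_integral (p + \<alpha>) Da t - A *v frac_integral (p + \<alpha>) Db t
      - B *v frac_integral (p + \<alpha>) y t"
    using p assms tT contD cont' sub[OF cont(1)]
    by (simp add: frac_integral_diff continuous_on_diff frac_integral_linear mv.bounded_linear_right)
  also have "frac_integral (p + \<alpha>) Da t = frac_integral (p + 2) y2 t"
    unfolding Da_def using frac_integral_semigroup[of "p + \<alpha>" "2 - \<alpha>" T y2 t] p assms tT cont
    by (simp add: algebra_simps)
  also have "frac_integral (p + \<alpha>) Db t = frac_integral (p + (\<alpha> - \<beta>) + 1) y1 t"
    unfolding Db_def using frac_integral_semigroup[of "p + \<alpha>" "1 - \<beta>" T y1 t] p assms tT cont
    by (simp add: algebra_simps)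
  also have "\<dots> = w (p + (\<alpha> - \<beta>))"
    using p assms by (intro J1) auto
  also have "frac_integral (p + \<alpha>) y t = w (p + \<alpha>) + (t powr (p + \<alpha>) / Gamma (p + \<alpha> + 1)) *\<^sub>R \<eta>"
    by (simp add: w_def)
  finally show ?thesis
    unfolding J2 by (simp add: mv.add_right)
qed

lemma double_summable_ml_term:
  assumes "a > 0" "b > 0" "t \<ge> 0" "c \<ge> 1" "d \<ge> 0"
  shows "double_summable (ml_term A B a b c d t)"
    and "(\<lambda>n. \<Sum>k\<le>n. ml_term A B a b c d t k (n - k)) sums double_suminf (ml_term A B a b c d t)"
proof -
  have "t + 1 > 0" using assms by simp
  then obtain C where "\<And>k m s. s \<in> {0..t + 1} \<Longrightarrow>
      norm (ml_term A B a b c d s k m) \<le> C * ((1/2) ^ k * (1/2) ^ m)"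
    using ml_term_bound[OF assms(1,2) _ assms(4,5), of "t + 1" A B] by metis
  then have "\<And>k m. norm (ml_term A B a b c d t k m) \<le> C * ((1/2) ^ k * (1/2) ^ m)"
    using assms by simp
  then show "double_summable (ml_term A B a b c d t)"
    "(\<lambda>n. \<Sum>k\<le>n. ml_term A B a b c d t k (n - k)) sums double_suminf (ml_term A B a b c d t)"
    by (rule double_summable_geometric diagonal_sums_double_suminf)+
qed

text \<open>
  Valid at \<open>t = 0\<close> as well, since \<open>powr_add\<close> holds for the base \<open>0\<close>.
\<close>

lemma scaled_mittag_leffler:
  assumes "a > 0" "b > 0" "t \<ge> 0" "c \<ge> 1"
  shows "t powr d *\<^sub>R mittag_leffler A B a b c t = double_suminf (ml_term A B a b c d t)"
proof -
  have eq: "ml_term A B a b c d t = (\<lambda>k m. t powr d *\<^sub>R ml_term A B a b c 0 t k m)"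
    by (simp add: fun_eq_iff ml_term_def powr_add)
  show ?thesis
    unfolding eq
    using double_summable_bounded_linear(2)[OF bounded_linear_scaleR_right
        double_summable_ml_term(1)[of a b t c 0 A B], of "t powr d"] assms
    by (simp add: mittag_leffler_def ml_term_0)
qed

text \<open>
  Since \<open>c > 1\<close>, the kernels \<open>(t - s) powr (k a + m b + c - 1)\<close> are continuous up to \<open>s = t\<close> and the
  diagonal series converges uniformly by the Weierstrass test, so it may be integrated term by
  term.
\<close>

lemma ml_convolution_sums:
  fixes A B :: "real^'n^'n"
  assumes "a > 0" "b > 0" "c > 1" "t > 0" "continuous_on {0..t} g"
  defines "F \<equiv> \<lambda>s. double_suminf (ml_term A B a b c (c - 1) (t - s)) *v g s"
  shows "F integrable_on {0..t}"
    and "(\<lambda>n. \<Sum>k\<le>n. Q_matrix A B k (n - k) *v frac_integral (real k * a + real (n - k) * b + c) g t)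
           sums integral {0..t} F"
proof -
  define f where "f k m s = ml_term A B a b c (c - 1) (t - s) k m *v g s" for k m s
  obtain C where C: "C \<ge> 0" "\<And>k m s. s \<in> {0..t} \<Longrightarrow>
      norm (ml_term A B a b c (c - 1) s k m) \<le> C * ((1/2) ^ k * (1/2) ^ m)"
    using ml_term_bound[of a b t c "c - 1" A B] assms by auto
  obtain K where K: "K > 0" "\<And>(X :: real^'n^'n) x. norm (X *v x) \<le> norm X * norm x * K"
    using bounded_bilinear.pos_bounded[OF bounded_bilinear_matrix_vector_mult[where 'n = 'n]] by blast
  have "bounded (g ` {0..t})"
    by (intro compact_imp_bounded compact_continuous_image assms) simp
  then obtain M where M: "M > 0" "\<And>s. s \<in> {0..t} \<Longrightarrow> norm (g s) \<le> M"
    unfolding bounded_pos by auto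
  have f_bound: "norm (f k m s) \<le> C * M * K * ((1/2) ^ k * (1/2) ^ m)" if "s \<in> {0..t}" for k m s
  proof -
    have "norm (f k m s) \<le> norm (ml_term A B a b c (c - 1) (t - s) k m) * norm (g s) * K"
      unfolding f_def by (rule K)
    also have "\<dots> \<le> (C * ((1/2) ^ k * (1/2) ^ m)) * M * K"
      using that K(1) M C by (intro mult_right_mono mult_mono) auto
    finally show ?thesis by (simp add: mult_ac)
  qed
  have f_int: "(f k m has_integral Q_matrix A B k m *v frac_integral (real k * a + real m * b + c) g t) {0..t}"
    and f_cont: "continuous_on {0..t} (f k m)" for k m
  proof -
    define p where "p = real k * a + real m * b + c"
    have "real k * a \<ge> 0" "real m * b \<ge> 0" using assms by auto
    then have p: "p > 1" using assms(3) unfolding p_def by linarith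
    have f_eq: "f k m = (\<lambda>s. ((1 / Gamma p) *\<^sub>R Q_matrix A B k m) *v ((t - s) powr (p - 1) *\<^sub>R g s))"
      by (simp add: fun_eq_iff f_def ml_term_def p_def add_diff_eq mv.scaleR_left mv.scaleR_right)
    have "((\<lambda>s. (t - s) powr (p - 1) *\<^sub>R g s) has_integral
        integral {0..t} (\<lambda>s. (t - s) powr (p - 1) *\<^sub>R g s)) {0..t}"
      using p assms by (intro integrable_integral weakly_singular_integrable) auto
    from has_integral_linear[OF this mv.bounded_linear_right[of "(1 / Gamma p) *\<^sub>R Q_matrix A B k m"]]
    show "(f k m has_integral Q_matrix A B k m *v frac_integral (real k * a + real m * b + c) g t) {0..t}"
      unfolding f_eq p_def[symmetric] using p
      by (simp add: o_def frac_integral_def mv.scaleR_left mv.scaleR_right)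
    have "continuous_on {0..t} (\<lambda>s. (t - s) powr (p - 1) *\<^sub>R g s)"
      using p by (intro continuous_intros continuous_on_powr' assms) auto
    then show "continuous_on {0..t} (f k m)"
      unfolding f_eq by (rule bounded_linear.continuous_on[OF mv.bounded_linear_right])
  qed
  have F_sums: "(\<lambda>n. \<Sum>k\<le>n. f k (n - k) s) sums F s" if "s \<in> {0..t}" for s
  proof -
    have "(\<lambda>n. (\<Sum>k\<le>n. ml_term A B a b c (c - 1) (t - s) k (n - k)) *v g s) sums F s"
      unfolding F_def using that assms
      by (intro bounded_linear.sums[OF mv.bounded_linear_left] double_summable_ml_term) auto
    then show ?thesis by (simp add: f_def mv.sum_left)
  qed
  have "uniform_limit {0..t} (\<lambda>N s. \<Sum>n<N. \<Sum>k\<le>n. f k (n - k) s)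
      (\<lambda>s. \<Sum>n. \<Sum>k\<le>n. f k (n - k) s) sequentially"
  proof (rule Weierstrass_m_test)
    show "norm (\<Sum>k\<le>n. f k (n - k) s) \<le> (\<Sum>k\<le>n. C * M * K * ((1/2) ^ k * (1/2) ^ (n - k)))"
      if "s \<in> {0..t}" for n s
      by (intro order_trans[OF norm_sum] sum_mono f_bound that)
    show "summable (\<lambda>n. \<Sum>k\<le>n. C * M * K * ((1/2) ^ k * (1/2) ^ (n - k)) :: real)"
      using C M K by (intro sums_summable[OF diagonal_sums_double_suminf[where C = "C * M * K"]]) auto
  qed
  then have unif: "uniform_limit {0..t} (\<lambda>N s. \<Sum>n<N. \<Sum>k\<le>n. f k (n - k) s) F sequentially"
    by (rule uniform_limit_cong'[THEN iffD1, rotated 2]) (use F_sums in \<open>auto simp: sums_iff\<close>)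
  obtain I J where IJ: "\<And>N. ((\<lambda>s. \<Sum>n<N. \<Sum>k\<le>n. f k (n - k) s) has_integral I N) {0..t}"
      "(F has_integral J) {0..t}" "I \<longlonglongrightarrow> J"
    by (rule uniform_limit_integral[OF unif]) (auto intro!: continuous_on_sum f_cont)
  show "F integrable_on {0..t}" using IJ(2) by blast
  have "I = (\<lambda>N. \<Sum>n<N. \<Sum>k\<le>n.
      Q_matrix A B k (n - k) *v frac_integral (real k * a + real (n - k) * b + c) g t)"
    by (rule ext, rule has_integral_unique[OF IJ(1)])
       (intro has_integral_sum f_int finite_lessThan finite_atMost)
  then show "(\<lambda>n. \<Sum>k\<le>n. Q_matrix A B k (n - k) *v frac_integral (real k * a + real (n - k) * b + c) g t)
           sums integral {0..t} F"
    using IJ(3) by (simp only: sums_def integral_unique[OF IJ(2)])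
qed

section \<open>The solution formula\<close>

text \<open>
  The Neumann series is applied to \<open>w k m\<close>, the fractional integral of \<open>y - \<eta>\<close> of order
  \<open>k a + m \<alpha>\<close> at the point \<open>t\<close>. Its inhomogeneity, known from \<open>ivp_frac_integral\<close>, consists of
  three terms, one for each summand of the solution formula. Working with \<open>y - \<eta>\<close> in place of
  \<open>y\<close> removes the term that \<open>A\<close> would contribute from the initial value, so that only
  \<open>Q_matrix A B k m ** B\<close> acts on \<open>\<eta>\<close>.
\<close>

lemma ivp_solution_formula:
  fixes A B :: "real^'n^'n"
  assumes "T > 0" "1 < \<alpha>" "\<alpha> \<le> 2" "0 < \<beta>" "\<beta> \<le> 1" "continuous_on {0..T} g"
    and y: "continuously_differentiable_on 2 {0..T} y" "solves_ivp T \<alpha> \<beta> A B g \<eta> \<eta>' y"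
    and t: "t \<in> {0<..T}"
  defines "E \<equiv> \<lambda>c d s. double_suminf (ml_term A B (\<alpha> - \<beta>) \<alpha> c d s)"
  shows "y t = \<eta> + (E (\<alpha> + 1) \<alpha> t ** B) *v \<eta> + E 2 1 t *v \<eta>'
           + integral {0..t} (\<lambda>s. E \<alpha> (\<alpha> - 1) (t - s) *v g s)"
proof -
  define a where "a = \<alpha> - \<beta>"
  define p where "p k m = real k * a + real m * \<alpha>" for k m :: nat
  define w where "w k m = frac_integral (p k m) y t - (t powr p k m / Gamma (p k m + 1)) *\<^sub>R \<eta>" for k m
  have a: "a > 0" using assms by (simp add: a_def)
  have \<alpha>: "\<alpha> > 0" using assms by simp
  have tT: "t > 0" "{0..t} \<subseteq> {0..T}" using t by auto
  have p: "p k m \<ge> 0" for k m using a \<alpha> by (simp add: p_def)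
  have p_Suc: "p (Suc k) m = p k m + a" "p k (Suc m) = p k m + \<alpha>" for k m
    by (simp_all add: p_def algebra_simps)
  have "continuous_on {0..T} y"
    using differentiable_imp_continuous_on[of y "{0..T}"] y(1)
    by (auto simp: continuously_differentiable_on_def dest: spec[of _ 0])
  then have y_cont: "continuous_on {0..t} y" using tT(2) by (rule continuous_on_subset)
  then have "bounded (y ` {0..t})"
    by (intro compact_imp_bounded compact_continuous_image) simp_all
  then obtain M where M: "\<And>s. s \<in> {0..t} \<Longrightarrow> norm (y s) \<le> M"
    unfolding bounded_iff by (metis imageI)
  obtain C where C: "C \<ge> 0" "\<And>k m s. s \<in> {0..t} \<Longrightarrow>
      norm (ml_term A B a \<alpha> 1 0 s k m) \<le> C * ((1/2) ^ k * (1/2) ^ m)"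
    using ml_term_bound[OF a \<alpha> tT(1), of 1 0 A B] by auto
  obtain K where K: "K > 0" "\<And>(X :: real^'n^'n) x. norm (X *v x) \<le> norm X * norm x * K"
    using bounded_bilinear.pos_bounded[OF bounded_bilinear_matrix_vector_mult[where 'n = 'n]] by blast
  have w_bound: "norm (w k m) \<le> t powr p k m / Gamma (p k m + 1) * (M + norm \<eta>)" for k m
  proof -
    have G: "Gamma (p k m + 1) > 0" using p[of k m] by simp
    have "norm (frac_integral (p k m) y t) \<le> t powr p k m / Gamma (p k m + 1) * M"
    proof (cases "p k m = 0")
      case True
      then show ?thesis using M[of t] tT by (simp add: frac_integral_def)
    next
      case False
      then show ?thesis using p[of k m] tT by (intro frac_integral_bound y_cont M) auto
    qed
    moreover have "norm ((t powr p k m / Gamma (p k m + 1)) *\<^sub>R \<eta>) = t powr p k m / Gamma (p k m + 1) * norm \<eta>"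
      using G by simp
    ultimately show ?thesis
      unfolding w_def distrib_left
      using norm_triangle_ineq4[of "frac_integral (p k m) y t" "(t powr p k m / Gamma (p k m + 1)) *\<^sub>R \<eta>"]
      by linarith
  qed
  have M0: "M + norm \<eta> \<ge> 0" using order_trans[OF norm_ge_zero M[of t]] tT by simp
  have "norm (Q_matrix A B k m *v w k m) \<le> C * (M + norm \<eta>) * K * ((1/2) ^ k * (1/2) ^ m)" for k m
  proof -
    have "norm (Q_matrix A B k m *v w k m) \<le> norm (Q_matrix A B k m) * norm (w k m) * K"
      by (rule K)
    also have "\<dots> \<le> norm (Q_matrix A B k m) * (t powr p k m / Gamma (p k m + 1) * (M + norm \<eta>)) * K"
      using K(1) by (intro mult_right_mono mult_left_mono w_bound) auto
    also have "\<dots> = norm (ml_term A B a \<alpha> 1 0 t k m) * (M + norm \<eta>) * K"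
      using Gamma_real_pos[of "p k m + 1"] p[of k m] by (simp add: ml_term_def p_def)
    also have "\<dots> \<le> (C * ((1/2) ^ k * (1/2) ^ m)) * (M + norm \<eta>) * K"
      using K(1) M0 tT by (intro mult_right_mono C) auto
    finally show ?thesis by (simp add: mult_ac)
  qed
  then have "(\<lambda>n. \<Sum>k\<le>n. Q_matrix A B k (n - k) *v
            (w k (n - k) - A *v w (Suc k) (n - k) - B *v w k (Suc (n - k)))) sums w 0 0"
    by (rule Q_matrix_neumann_sums)
  moreover have "w 0 0 = y t - \<eta>"
    using tT by (simp add: w_def p_def frac_integral_def)
  moreover have "Q_matrix A B k m *v (w k m - A *v w (Suc k) m - B *v w k (Suc m))
      = (ml_term A B a \<alpha> (\<alpha> + 1) \<alpha> t k m ** B) *v \<eta> + ml_term A B a \<alpha> 2 1 t k m *v \<eta>'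
        + Q_matrix A B k m *v frac_integral (real k * a + real m * \<alpha> + \<alpha>) g t" for k m
  proof -
    have "w k m - A *v w (Suc k) m - B *v w k (Suc m)
       = frac_integral (p k m + \<alpha>) g t + (t powr (p k m + 1) / Gamma (p k m + 2)) *\<^sub>R \<eta>'
         + B *v ((t powr (p k m + \<alpha>) / Gamma (p k m + \<alpha> + 1)) *\<^sub>R \<eta>)"
      using ivp_frac_integral[OF assms(1-5) y t p[of k m]]
      unfolding w_def p_Suc a_def[symmetric] .
    then show ?thesis
      by (simp add: ml_term_def p_def mv.add_right mv.scaleR_left mv.scaleR_right mm.scaleR_left
          matrix_vector_mul_assoc add.assoc)
  qed
  ultimately have "(\<lambda>n. \<Sum>k\<le>n. (ml_term A B a \<alpha> (\<alpha> + 1) \<alpha> t k (n - k) ** B) *v \<eta>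
        + ml_term A B a \<alpha> 2 1 t k (n - k) *v \<eta>'
        + Q_matrix A B k (n - k) *v frac_integral (real k * a + real (n - k) * \<alpha> + \<alpha>) g t) sums (y t - \<eta>)"
    by simp
  moreover have "(\<lambda>n. \<Sum>k\<le>n. (ml_term A B a \<alpha> (\<alpha> + 1) \<alpha> t k (n - k) ** B) *v \<eta>
        + ml_term A B a \<alpha> 2 1 t k (n - k) *v \<eta>'
        + Q_matrix A B k (n - k) *v frac_integral (real k * a + real (n - k) * \<alpha> + \<alpha>) g t)
      sums ((E (\<alpha> + 1) \<alpha> t ** B) *v \<eta> + E 2 1 t *v \<eta>'
        + integral {0..t} (\<lambda>s. E \<alpha> (\<alpha> - 1) (t - s) *v g s))"
    unfolding sum.distrib E_def a_def[symmetric]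
  proof (intro sums_add)
    have "(\<lambda>n. (\<Sum>k\<le>n. ml_term A B a \<alpha> (\<alpha> + 1) \<alpha> t k (n - k)) ** B *v \<eta>)
        sums (double_suminf (ml_term A B a \<alpha> (\<alpha> + 1) \<alpha> t) ** B *v \<eta>)"
      using a \<alpha> tT
      by (intro bounded_linear.sums[OF bounded_linear_compose[OF mv.bounded_linear_left mm.bounded_linear_left]]
          double_summable_ml_term) auto
    then show "(\<lambda>n. \<Sum>k\<le>n. ml_term A B a \<alpha> (\<alpha> + 1) \<alpha> t k (n - k) ** B *v \<eta>)
        sums (double_suminf (ml_term A B a \<alpha> (\<alpha> + 1) \<alpha> t) ** B *v \<eta>)"
      by (simp add: mm.sum_left mv.sum_left)
    have "(\<lambda>n. (\<Sum>k\<le>n. ml_term A B a \<alpha> 2 1 t k (n - k)) *v \<eta>')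
        sums (double_suminf (ml_term A B a \<alpha> 2 1 t) *v \<eta>')"
      using a \<alpha> tT
      by (intro bounded_linear.sums[OF mv.bounded_linear_left] double_summable_ml_term) auto
    then show "(\<lambda>n. \<Sum>k\<le>n. ml_term A B a \<alpha> 2 1 t k (n - k) *v \<eta>')
        sums (double_suminf (ml_term A B a \<alpha> 2 1 t) *v \<eta>')"
      by (simp add: mv.sum_left)
    show "(\<lambda>n. \<Sum>k\<le>n. Q_matrix A B k (n - k) *v frac_integral (real k * a + real (n - k) * \<alpha> + \<alpha>) g t)
        sums integral {0..t} (\<lambda>s. double_suminf (ml_term A B a \<alpha> \<alpha> (\<alpha> - 1) (t - s)) *v g s)"
      using a \<alpha> tT assms by (intro ml_convolution_sums continuous_on_subset[OF assms(6)]) auto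
  qed
  ultimately show ?thesis
    using sums_unique2 by (fastforce simp: algebra_simps)
qed

theorem mainTheorem9:
  fixes A\<^sub>0 B\<^sub>0 :: "real^'n^'n"
    and \<eta> \<eta>' :: "real^'n"
    and g y :: "real \<Rightarrow> real^'n"
    and T \<alpha> \<beta> :: real
  assumes "T > 0"
    and "A\<^sub>0 ** B\<^sub>0 \<noteq> B\<^sub>0 ** A\<^sub>0"
    and "1 < \<alpha>" "\<alpha> \<le> 2" "0 < \<beta>" "\<beta> \<le> 1"
    and "continuous_on {0..T} g"
    and "continuously_differentiable_on 2 {0..T} y"
    and "solves_ivp T \<alpha> \<beta> A\<^sub>0 B\<^sub>0 g \<eta> \<eta>' y"
  shows
    "(\<forall>t\<in>{0<..T}.
       double_summable (mittag_leffler_term A\<^sub>0 B\<^sub>0 (\<alpha> - \<beta>) \<alpha> (\<alpha> + 1) t) \<and>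
       double_summable (mittag_leffler_term A\<^sub>0 B\<^sub>0 (\<alpha> - \<beta>) \<alpha> 2 t) \<and>
       double_summable (mittag_leffler_term A\<^sub>0 B\<^sub>0 (\<alpha> - \<beta>) \<alpha> \<alpha> t) \<and>
       double_summable (\<lambda>k m. (t powr (real k * (\<alpha> - \<beta>) + real m * \<alpha> + \<alpha>)
           / Gamma (real k * (\<alpha> - \<beta>) + real m * \<alpha> + \<alpha> + 1)) *\<^sub>R (Q_matrix A\<^sub>0 B\<^sub>0 k m ** B\<^sub>0)) \<and>
       double_summable (\<lambda>k m. (t powr (real k * (\<alpha> - \<beta>) + real m * \<alpha> + 1)
           / Gamma (real k * (\<alpha> - \<beta>) + real m * \<alpha> + 2)) *\<^sub>R Q_matrix A\<^sub>0 B\<^sub>0 k m) \<and>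
       double_summable (\<lambda>k m. (t powr (real k * (\<alpha> - \<beta>) + real m * \<alpha> + \<alpha> - 1)
           / Gamma (real k * (\<alpha> - \<beta>) + real m * \<alpha> + \<alpha>)) *\<^sub>R Q_matrix A\<^sub>0 B\<^sub>0 k m) \<and>
       (\<lambda>s. ((t - s) powr (\<alpha> - 1) *\<^sub>R mittag_leffler A\<^sub>0 B\<^sub>0 (\<alpha> - \<beta>) \<alpha> \<alpha> (t - s)) *v g s)
         integrable_on {0..t} \<and>
       (\<lambda>s. double_suminf (\<lambda>k m. ((t - s) powr (real k * (\<alpha> - \<beta>) + real m * \<alpha> + \<alpha> - 1)
           / Gamma (real k * (\<alpha> - \<beta>) + real m * \<alpha> + \<alpha>)) *\<^sub>R Q_matrix A\<^sub>0 B\<^sub>0 k m) *v g s)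
         integrable_on {0..t})
     \<and>
     (\<forall>t\<in>{0<..T}.
       y t = (mat 1 + t powr \<alpha> *\<^sub>R (mittag_leffler A\<^sub>0 B\<^sub>0 (\<alpha> - \<beta>) \<alpha> (\<alpha> + 1) t ** B\<^sub>0)) *v \<eta>
           + (t *\<^sub>R mittag_leffler A\<^sub>0 B\<^sub>0 (\<alpha> - \<beta>) \<alpha> 2 t) *v \<eta>'
           + integral {0..t} (\<lambda>s.
               ((t - s) powr (\<alpha> - 1) *\<^sub>R mittag_leffler A\<^sub>0 B\<^sub>0 (\<alpha> - \<beta>) \<alpha> \<alpha> (t - s)) *v g s))
     \<and>
     (\<forall>t\<in>{0<..T}.
       y t = (mat 1 + double_suminf (\<lambda>k m. (t powr (real k * (\<alpha> - \<beta>) + real m * \<alpha> + \<alpha>)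
               / Gamma (real k * (\<alpha> - \<beta>) + real m * \<alpha> + \<alpha> + 1)) *\<^sub>R (Q_matrix A\<^sub>0 B\<^sub>0 k m ** B\<^sub>0))) *v \<eta>
           + double_suminf (\<lambda>k m. (t powr (real k * (\<alpha> - \<beta>) + real m * \<alpha> + 1)
               / Gamma (real k * (\<alpha> - \<beta>) + real m * \<alpha> + 2)) *\<^sub>R Q_matrix A\<^sub>0 B\<^sub>0 k m) *v \<eta>'
           + integral {0..t} (\<lambda>s.
               double_suminf (\<lambda>k m. ((t - s) powr (real k * (\<alpha> - \<beta>) + real m * \<alpha> + \<alpha> - 1)
                 / Gamma (real k * (\<alpha> - \<beta>) + real m * \<alpha> + \<alpha>)) *\<^sub>R Q_matrix A\<^sub>0 B\<^sub>0 k m) *v g s))"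
proof -
  define a where "a = \<alpha> - \<beta>"
  have a: "a > 0" and \<alpha>: "\<alpha> > 1" "\<alpha> > 0" using assms by (auto simp: a_def)
  define E where "E c d s = double_suminf (ml_term A\<^sub>0 B\<^sub>0 a \<alpha> c d s)" for c d s
  have S1: "(\<lambda>k m. (t powr (real k * a + real m * \<alpha> + \<alpha>)
           / Gamma (real k * a + real m * \<alpha> + \<alpha> + 1)) *\<^sub>R (Q_matrix A\<^sub>0 B\<^sub>0 k m ** B\<^sub>0))
       = (\<lambda>k m. ml_term A\<^sub>0 B\<^sub>0 a \<alpha> (\<alpha> + 1) \<alpha> t k m ** B\<^sub>0)" for t
    by (simp add: fun_eq_iff ml_term_def mm.scaleR_left add.assoc)
  have S2: "(\<lambda>k m. (t powr (real k * a + real m * \<alpha> + 1)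
           / Gamma (real k * a + real m * \<alpha> + 2)) *\<^sub>R Q_matrix A\<^sub>0 B\<^sub>0 k m)
       = ml_term A\<^sub>0 B\<^sub>0 a \<alpha> 2 1 t" for t
    by (simp add: fun_eq_iff ml_term_def)
  have S3: "(\<lambda>k m. (t powr (real k * a + real m * \<alpha> + \<alpha> - 1)
           / Gamma (real k * a + real m * \<alpha> + \<alpha>)) *\<^sub>R Q_matrix A\<^sub>0 B\<^sub>0 k m)
       = ml_term A\<^sub>0 B\<^sub>0 a \<alpha> \<alpha> (\<alpha> - 1) t" for t
    by (simp add: fun_eq_iff ml_term_def add_diff_eq)
  have summ: "double_summable (ml_term A\<^sub>0 B\<^sub>0 a \<alpha> c d t)" if "t > 0" "c \<ge> 1" "d \<ge> 0" for c d t
    using that a \<alpha> by (intro double_summable_ml_term) auto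
  have summ0: "double_summable (mittag_leffler_term A\<^sub>0 B\<^sub>0 a \<alpha> c t)" if "t > 0" "c \<ge> 1" for c t
    using summ[of t c 0] that by (simp add: ml_term_0)
  have E_right: "double_summable (\<lambda>k m. ml_term A\<^sub>0 B\<^sub>0 a \<alpha> (\<alpha> + 1) \<alpha> t k m ** B\<^sub>0)"
    "double_suminf (\<lambda>k m. ml_term A\<^sub>0 B\<^sub>0 a \<alpha> (\<alpha> + 1) \<alpha> t k m ** B\<^sub>0) = E (\<alpha> + 1) \<alpha> t ** B\<^sub>0"
    if "t > 0" for t
    unfolding E_def using that \<alpha>
    by (intro double_summable_bounded_linear[OF mm.bounded_linear_left] summ; simp)+
  have scaled: "t powr d *\<^sub>R mittag_leffler A\<^sub>0 B\<^sub>0 a \<alpha> c t = E c d t" if "t \<ge> 0" "c \<ge> 1" for c d t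
    unfolding E_def using that a \<alpha> by (intro scaled_mittag_leffler) auto
  have scaled_right: "t powr \<alpha> *\<^sub>R (mittag_leffler A\<^sub>0 B\<^sub>0 a \<alpha> (\<alpha> + 1) t ** B\<^sub>0) = E (\<alpha> + 1) \<alpha> t ** B\<^sub>0"
    if "t \<ge> 0" for t
    unfolding mm.scaleR_left[symmetric] using that \<alpha> by (simp add: scaled)
  have scaled_1: "t *\<^sub>R mittag_leffler A\<^sub>0 B\<^sub>0 a \<alpha> 2 t = E 2 1 t" if "t > 0" for t
    using scaled[of t 2 1] that by simp
  have integrand: "((t - s) powr (\<alpha> - 1) *\<^sub>R mittag_leffler A\<^sub>0 B\<^sub>0 a \<alpha> \<alpha> (t - s)) *v g s
       = E \<alpha> (\<alpha> - 1) (t - s) *v g s" if "s \<in> {0..t}" for s t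
    using that \<alpha> by (simp add: scaled)
  have int: "(\<lambda>s. E \<alpha> (\<alpha> - 1) (t - s) *v g s) integrable_on {0..t}" if "t \<in> {0<..T}" for t
    unfolding E_def using that a \<alpha>
    by (intro ml_convolution_sums continuous_on_subset[OF assms(7)]) auto
  have int_scaled: "(\<lambda>s. ((t - s) powr (\<alpha> - 1) *\<^sub>R mittag_leffler A\<^sub>0 B\<^sub>0 a \<alpha> \<alpha> (t - s)) *v g s)
         integrable_on {0..t}" if "t \<in> {0<..T}" for t
    using int[OF that] by (rule integrable_eq) (simp add: integrand)
  have integral_scaled: "integral {0..t} (\<lambda>s.
       ((t - s) powr (\<alpha> - 1) *\<^sub>R mittag_leffler A\<^sub>0 B\<^sub>0 a \<alpha> \<alpha> (t - s)) *v g s)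
       = integral {0..t} (\<lambda>s. E \<alpha> (\<alpha> - 1) (t - s) *v g s)" for t
    by (intro integral_cong integrand)
  have sol: "y t = (mat 1 + E (\<alpha> + 1) \<alpha> t ** B\<^sub>0) *v \<eta> + E 2 1 t *v \<eta>'
           + integral {0..t} (\<lambda>s. E \<alpha> (\<alpha> - 1) (t - s) *v g s)" if "t \<in> {0<..T}" for t
    using ivp_solution_formula[OF assms(1,3-9) that]
    by (simp add: E_def a_def mv.add_left)
  show ?thesis
    unfolding a_def[symmetric] S1 S2 S3 E_def[symmetric]
    using \<alpha> by (intro conjI ballI)
      (auto simp: scaled_right scaled_1 integral_scaled E_right intro!: summ summ0 int int_scaled sol)
qed

end
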